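(* Let $S$ be a completely regular semigroup. The following conditions are equivalent. (1) $\kappa$ is over rectangular bands; (2) $\beta\cap\mathcal{F}=\beta\cap\Theta=\beta\cap\tau$; (3) $\beta\cap\Theta$ is a congruence on $S$; (4) $\kappa\cap\mathcal{H}=\varepsilon$; (5) $\kappa\subseteq\tau$; (6) $\kappa_k=\varepsilon$; (7) there exists an idempotent pure cryptogroup congruence on $S$; (8) $\kappa\subseteq\mathcal{F}$; (9) $S$ is a band of rectangular groups with $\operatorname{tr}\beta\subseteq\operatorname{tr}\tau$; (10) $\kappa\subseteq\mathcal{Y}$.
   Context: A completely regular semigroup is a semigroup that is a union of its subgroups; for $a\in S$, $a^{-1}$ is the inverse of $a$ in the maximal subgroup containing $a$, and $a^0=aa^{-1}=a^{-1}a$. $E(S)$ is the set of idempotents of $S$, $V(a)$ the set of all inverses of $a$ in $S$ (elements $x$ with $a=axa$, $x=xax$), $\mathcal{H}$ is Green's relation, and $\varepsilon$ is the equality relation. Relations on $S$: $a\,\mathcal{F}\,b\iff ab^{-1}\in E(S)$; $a\,\mathcal{Y}\,b\iff V(a)=V(b)$; $a\,\Theta\,b\iff a^0b=ab^0$. A band is a semigroup of idempotents; a rectangular band is a semigroup satisfying $a=axa$; a rectangular group is a semigroup isomorphic to the direct product of a rectangular band and a group. A cryptogroup is a completely regular semigroup on which $\mathcal{H}$ is a congruence; a cryptogroup (resp. band) congruence on $S$ is one whose quotient is a cryptogroup (resp. band). $\beta$ is the least band congruence on $S$ and $\kappa$ is the least cryptogroup congruence on $S$. The congruence $\kappa$ is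 over rectangular bands if $e\kappa$ is a rectangular band for each $e\in E(S)$. $S$ is a band of rectangular groups if there is a band congruence on $S$ each of whose classes is a rectangular group. For a congruence $\rho$ on $S$: $\operatorname{tr}\rho=\rho|_{E(S)}$, $\ker\rho=\{a\in S: a\,\rho\,e\text{ for some }e\in E(S)\}$, and $\rho_k$ is the least congruence on $S$ with the same kernel as $\rho$. A congruence $\rho$ is idempotent pure if $a\,\rho\,e$ with $a\in S$, $e\in E(S)$ implies $a\in E(S)$; $\tau$ is the greatest idempotent pure congruence on $S$. *)

theory Defs
  imports "HOL-Algebra.Group"
begin

text \<open>
  Semigroups are given by an explicit carrier, since quotients by congruences and subsemigroups
  carried by congruence classes have to be treated as semigroups as well. The empty semigroup
  is not excluded.
\<close>

record 'a semigrp = "'a partial_object" +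
  sgmult :: "'a \<Rightarrow> 'a \<Rightarrow> 'a" (infixl "\<cdot>\<index>" 70)

locale semigrp =
  fixes S :: "'a semigrp" (structure)
  assumes closed: "\<lbrakk>a \<in> carrier S; b \<in> carrier S\<rbrakk> \<Longrightarrow> a \<cdot> b \<in> carrier S"
    and assoc: "\<lbrakk>a \<in> carrier S; b \<in> carrier S; c \<in> carrier S\<rbrakk> \<Longrightarrow> (a \<cdot> b) \<cdot> c = a \<cdot> (b \<cdot> c)"

definition subsemigrp :: "'a semigrp \<Rightarrow> 'a set \<Rightarrow> 'a semigrp" where
  "subsemigrp S A = \<lparr>carrier = A, sgmult = sgmult S\<rparr>"

definition semigrp_iso :: "'a semigrp \<Rightarrow> 'b semigrp \<Rightarrow> bool" where
  "semigrp_iso S T \<longleftrightarrow> (\<exists>\<phi>. bij_betw \<phi> (carrier S) (carrier T) \<and>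
     (\<forall>a\<in>carrier S. \<forall>b\<in>carrier S. \<phi> (a \<cdot>\<^bsub>S\<^esub> b) = \<phi> a \<cdot>\<^bsub>T\<^esub> \<phi> b))"

definition idempotents :: "'a semigrp \<Rightarrow> 'a set" where
  "idempotents S = {e \<in> carrier S. e \<cdot>\<^bsub>S\<^esub> e = e}"

definition inverses :: "'a semigrp \<Rightarrow> 'a \<Rightarrow> 'a set" where
  "inverses S a = {x \<in> carrier S. a = a \<cdot>\<^bsub>S\<^esub> x \<cdot>\<^bsub>S\<^esub> a \<and> x = x \<cdot>\<^bsub>S\<^esub> a \<cdot>\<^bsub>S\<^esub> x}"


subsection \<open>Completely regular semigroups\<close>

text \<open>The subset H with the multiplication of S, completed by its identity (if there is one)
  so that it can be a group in the sense of the library.\<close>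

definition group_on :: "'a semigrp \<Rightarrow> 'a set \<Rightarrow> 'a monoid" where
  "group_on S H = \<lparr>carrier = H, mult = sgmult S,
     one = (THE e. e \<in> H \<and> (\<forall>x\<in>H. e \<cdot>\<^bsub>S\<^esub> x = x \<and> x \<cdot>\<^bsub>S\<^esub> e = x))\<rparr>"

definition subgroup_of :: "'a semigrp \<Rightarrow> 'a set \<Rightarrow> bool" where
  "subgroup_of S H \<longleftrightarrow> H \<subseteq> carrier S \<and> group (group_on S H)"

definition completely_regular :: "'a semigrp \<Rightarrow> bool" where
  "completely_regular S \<longleftrightarrow> semigrp S \<and> carrier S = \<Union>{H. subgroup_of S H}"

definition maximal_subgroup :: "'a semigrp \<Rightarrow> 'a \<Rightarrow> 'a set" where
  "maximal_subgroup S a = (GREATEST H. subgroup_of S H \<and> a \<in> H)"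

definition cr_inv :: "'a semigrp \<Rightarrow> 'a \<Rightarrow> 'a" where
  "cr_inv S a = inv\<^bsub>group_on S (maximal_subgroup S a)\<^esub> a"

definition cr_zero :: "'a semigrp \<Rightarrow> 'a \<Rightarrow> 'a" where
  "cr_zero S a = a \<cdot>\<^bsub>S\<^esub> cr_inv S a"


subsection \<open>Relations\<close>

definition rel_F :: "'a semigrp \<Rightarrow> 'a rel" where
  "rel_F S = {(a, b) \<in> carrier S \<times> carrier S. a \<cdot>\<^bsub>S\<^esub> cr_inv S b \<in> idempotents S}"

definition rel_Y :: "'a semigrp \<Rightarrow> 'a rel" where
  "rel_Y S = {(a, b) \<in> carrier S \<times> carrier S. inverses S a = inverses S b}"

definition rel_Theta :: "'a semigrp \<Rightarrow> 'a rel" where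
  "rel_Theta S = {(a, b) \<in> carrier S \<times> carrier S. cr_zero S a \<cdot>\<^bsub>S\<^esub> b = a \<cdot>\<^bsub>S\<^esub> cr_zero S b}"

text \<open>Green's relations compare principal one-sided ideals, which contain their generator.\<close>

definition green_L :: "'a semigrp \<Rightarrow> 'a rel" where
  "green_L S = {(a, b) \<in> carrier S \<times> carrier S.
     insert a ((\<lambda>x. x \<cdot>\<^bsub>S\<^esub> a) ` carrier S) = insert b ((\<lambda>x. x \<cdot>\<^bsub>S\<^esub> b) ` carrier S)}"

definition green_R :: "'a semigrp \<Rightarrow> 'a rel" where
  "green_R S = {(a, b) \<in> carrier S \<times> carrier S.
     insert a ((\<lambda>x. a \<cdot>\<^bsub>S\<^esub> x) ` carrier S) = insert b ((\<lambda>x. b \<cdot>\<^bsub>S\<^esub> x) ` carrier S)}"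

definition green_H :: "'a semigrp \<Rightarrow> 'a rel" where
  "green_H S = green_L S \<inter> green_R S"


subsection \<open>Congruences\<close>

definition congruence :: "'a semigrp \<Rightarrow> 'a rel \<Rightarrow> bool" where
  "congruence S \<rho> \<longleftrightarrow> equiv (carrier S) \<rho> \<and>
     (\<forall>(a, b)\<in>\<rho>. \<forall>c\<in>carrier S. (c \<cdot>\<^bsub>S\<^esub> a, c \<cdot>\<^bsub>S\<^esub> b) \<in> \<rho> \<and> (a \<cdot>\<^bsub>S\<^esub> c, b \<cdot>\<^bsub>S\<^esub> c) \<in> \<rho>)"

text \<open>For a congruence, the set in the product below is the class of any \<open>a \<cdot> b\<close>
  with \<open>a \<in> A\<close>, \<open>b \<in> B\<close>.\<close>

definition quotient_semigrp :: "'a semigrp \<Rightarrow> 'a rel \<Rightarrow> 'a set semigrp" where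
  "quotient_semigrp S \<rho> = \<lparr>carrier = carrier S // \<rho>,
     sgmult = (\<lambda>A B. \<rho> `` {a \<cdot>\<^bsub>S\<^esub> b | a b. a \<in> A \<and> b \<in> B})\<rparr>"

definition trace :: "'a semigrp \<Rightarrow> 'a rel \<Rightarrow> 'a rel" where
  "trace S \<rho> = \<rho> \<inter> idempotents S \<times> idempotents S"

definition kern :: "'a semigrp \<Rightarrow> 'a rel \<Rightarrow> 'a set" where
  "kern S \<rho> = {a \<in> carrier S. \<exists>e\<in>idempotents S. (a, e) \<in> \<rho>}"

definition idempotent_pure :: "'a semigrp \<Rightarrow> 'a rel \<Rightarrow> bool" where
  "idempotent_pure S \<rho> \<longleftrightarrow>
     (\<forall>a\<in>carrier S. \<forall>e\<in>idempotents S. (a, e) \<in> \<rho> \<longrightarrow> a \<in> idempotents S)"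


subsection \<open>Bands, rectangular groups, cryptogroups\<close>

definition band :: "'a semigrp \<Rightarrow> bool" where
  "band S \<longleftrightarrow> semigrp S \<and> (\<forall>a\<in>carrier S. a \<cdot>\<^bsub>S\<^esub> a = a)"

definition rectangular_band :: "'a semigrp \<Rightarrow> bool" where
  "rectangular_band S \<longleftrightarrow> semigrp S \<and>
     (\<forall>a\<in>carrier S. \<forall>x\<in>carrier S. a = a \<cdot>\<^bsub>S\<^esub> x \<cdot>\<^bsub>S\<^esub> a)"

definition direct_product :: "'a semigrp \<Rightarrow> 'b monoid \<Rightarrow> ('a \<times> 'b) semigrp" where
  "direct_product B G = \<lparr>carrier = carrier B \<times> carrier G,
     sgmult = (\<lambda>(a, g) (b, h). (a \<cdot>\<^bsub>B\<^esub> b, g \<otimes>\<^bsub>G\<^esub> h))\<rparr>"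

text \<open>Choosing the factors \<open>B\<close> and \<open>G\<close> over the element type of \<open>S\<close> is no restriction: if \<open>S\<close> is
  isomorphic to some \<open>B \<times> G\<close> and nonempty, then \<open>B\<close> and \<open>G\<close> are isomorphic to
  subsemigroups of \<open>S\<close>; if \<open>S\<close> is empty, so is \<open>B\<close>, and \<open>G\<close> can be taken trivial.\<close>

definition rectangular_group :: "'a semigrp \<Rightarrow> bool" where
  "rectangular_group S \<longleftrightarrow> semigrp S \<and>
     (\<exists>(B :: 'a semigrp) (G :: 'a monoid).
        rectangular_band B \<and> group G \<and> semigrp_iso S (direct_product B G))"

definition cryptogroup :: "'a semigrp \<Rightarrow> bool" where
  "cryptogroup S \<longleftrightarrow> completely_regular S \<and> congruence S (green_H S)"

definition band_congruence :: "'a semigrp \<Rightarrow> 'a rel \<Rightarrow> bool" where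
  "band_congruence S \<rho> \<longleftrightarrow> congruence S \<rho> \<and> band (quotient_semigrp S \<rho>)"

definition cryptogroup_congruence :: "'a semigrp \<Rightarrow> 'a rel \<Rightarrow> bool" where
  "cryptogroup_congruence S \<rho> \<longleftrightarrow> congruence S \<rho> \<and> cryptogroup (quotient_semigrp S \<rho>)"

definition over_rectangular_bands :: "'a semigrp \<Rightarrow> 'a rel \<Rightarrow> bool" where
  "over_rectangular_bands S \<rho> \<longleftrightarrow>
     (\<forall>e\<in>idempotents S. rectangular_band (subsemigrp S (\<rho> `` {e})))"

definition band_of_rectangular_groups :: "'a semigrp \<Rightarrow> bool" where
  "band_of_rectangular_groups S \<longleftrightarrow>
     (\<exists>\<rho>. band_congruence S \<rho> \<and> (\<forall>A\<in>carrier S // \<rho>. rectangular_group (subsemigrp S A)))"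


subsection \<open>Extremal congruences\<close>

text \<open>Least and greatest are with respect to inclusion of relations. On a completely regular
  semigroup all four congruences exist.\<close>

definition beta :: "'a semigrp \<Rightarrow> 'a rel" where
  "beta S = (LEAST \<rho>. band_congruence S \<rho>)"

definition kappa :: "'a semigrp \<Rightarrow> 'a rel" where
  "kappa S = (LEAST \<rho>. cryptogroup_congruence S \<rho>)"

definition tau :: "'a semigrp \<Rightarrow> 'a rel" where
  "tau S = (GREATEST \<rho>. congruence S \<rho> \<and> idempotent_pure S \<rho>)"

definition lower_k :: "'a semigrp \<Rightarrow> 'a rel \<Rightarrow> 'a rel" where
  "lower_k S \<rho> = (LEAST \<sigma>. congruence S \<sigma> \<and> kern S \<sigma> = kern S \<rho>)"

end

theory Submission
  imports Defs
begin

text \<open>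
  All conditions are compared with idempotent purity of \<open>\<kappa>\<close>. A congruence respects \<open>a \<mapsto> a\<^sup>0\<close>, so it is
  a band congruence iff it relates each \<open>a\<close> to \<open>a\<^sup>2\<close>, and a cryptogroup congruence iff it relates
  \<open>(a b)\<^sup>0\<close> to \<open>(a\<^sup>0 b\<^sup>0)\<^sup>0\<close>; hence \<open>\<beta>\<close> and \<open>\<kappa>\<close> exist, \<open>a \<beta> b\<close> iff \<open>a\<^sup>0 \<kappa> b\<^sup>0\<close>, and
  \<open>\<beta>\<close> and \<open>\<kappa>\<close> have the same trace. Since \<open>\<kappa>\<close> lies in Green's relation \<open>\<J>\<close> and idempotents are
  primitive in their \<open>\<J>\<close>-class, the class of an idempotent under an idempotent pure \<open>\<kappa>\<close> is a
  rectangular band, which gives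
  \<open>\<beta> \<inter> \<F> \<subseteq> \<beta> \<inter> \<Theta> \<subseteq> \<kappa> \<subseteq> \<beta> \<inter> \<tau> \<subseteq> \<beta> \<inter> \<F>\<close>. Conversely, \<open>\<beta> \<inter> \<Theta>\<close> (when it is a
  congruence) and \<open>\<tau>\<close> (when its trace contains that of \<open>\<beta>\<close>) are cryptogroup congruences that
  relate \<open>a\<close> to \<open>a\<^sup>0\<close> only if \<open>a = a\<^sup>0\<close>.
\<close>

subsection \<open>Maximal subgroups\<close>

context semigrp
begin

text \<open>For an idempotent \<open>e\<close> this is the group of units of the local monoid of all
  \<open>e \<cdot> x \<cdot> e\<close>; the witness \<open>y\<close> is confined to that monoid as
  well. These groups turn out to be the maximal subgroups.\<close>

definition units_at :: "'a \<Rightarrow> 'a set" where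
  "units_at e = {x \<in> carrier S. e \<cdot> x = x \<and> x \<cdot> e = x \<and>
     (\<exists>y\<in>carrier S. e \<cdot> y = y \<and> y \<cdot> e = y \<and> x \<cdot> y = e \<and> y \<cdot> x = e)}"

text \<open>The identity in \<open>group_on\<close> is a definite description, so it is computed by
  exhibiting a two-sided identity in \<open>H\<close>; two such elements coincide.\<close>

lemma one_group_on:
  assumes "e \<in> H" "\<And>x. x \<in> H \<Longrightarrow> e \<cdot> x = x \<and> x \<cdot> e = x"
  shows "\<one>\<^bsub>group_on S H\<^esub> = e"
proof -
  have "(THE e. e \<in> H \<and> (\<forall>x\<in>H. e \<cdot> x = x \<and> x \<cdot> e = x)) = e"
  proof (rule the_equality)
    show "f = e" if "f \<in> H \<and> (\<forall>x\<in>H. f \<cdot> x = x \<and> x \<cdot> f = x)" for f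
      using that assms by metis
  qed (use assms in blast)
  then show ?thesis by (simp add: group_on_def)
qed

lemma idempotent_in_units_at: "e \<in> idempotents S \<Longrightarrow> e \<in> units_at e"
  by (auto simp: units_at_def idempotents_def)

lemma mult_in_units_at:
  assumes "e \<in> idempotents S" "x \<in> units_at e" "y \<in> units_at e"
  shows "x \<cdot> y \<in> units_at e"
proof -
  have C: "e \<in> carrier S" "x \<in> carrier S" "y \<in> carrier S"
    using assms by (auto simp: units_at_def idempotents_def)
  obtain x' where x': "x' \<in> carrier S" "e \<cdot> x' = x'" "x' \<cdot> e = x'" "x \<cdot> x' = e" "x' \<cdot> x = e"
    using assms by (auto simp: units_at_def)
  obtain y' where y': "y' \<in> carrier S" "e \<cdot> y' = y'" "y' \<cdot> e = y'" "y \<cdot> y' = e" "y' \<cdot> y = e"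
    using assms by (auto simp: units_at_def)
  have u: "e \<cdot> x = x" "x \<cdot> e = x" "e \<cdot> y = y" "y \<cdot> e = y"
    using assms by (auto simp: units_at_def)
  have "(x \<cdot> y) \<cdot> (y' \<cdot> x') = x \<cdot> ((y \<cdot> y') \<cdot> x')"
    using C x'(1) y'(1) by (simp add: assoc closed)
  moreover have "(y' \<cdot> x') \<cdot> (x \<cdot> y) = y' \<cdot> ((x' \<cdot> x) \<cdot> y)"
    using C x'(1) y'(1) by (simp add: assoc closed)
  ultimately have "(x \<cdot> y) \<cdot> (y' \<cdot> x') = e" "(y' \<cdot> x') \<cdot> (x \<cdot> y) = e"
    using x' y' u by simp_all
  moreover have "e \<cdot> (x \<cdot> y) = x \<cdot> y" "e \<cdot> (y' \<cdot> x') = y' \<cdot> x'"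
    using C x'(1,2) y'(1,2) u by (simp_all flip: assoc)
  moreover have "(x \<cdot> y) \<cdot> e = x \<cdot> y" "(y' \<cdot> x') \<cdot> e = y' \<cdot> x'"
    using C x'(1,3) y'(1,3) u by (simp_all add: assoc)
  moreover have "x \<cdot> y \<in> carrier S" "y' \<cdot> x' \<in> carrier S"
    using C x' y' by (simp_all add: closed)
  ultimately show ?thesis
    unfolding units_at_def by blast
qed

lemma one_units_at:
  assumes "e \<in> idempotents S"
  shows "\<one>\<^bsub>group_on S (units_at e)\<^esub> = e"
  using assms by (intro one_group_on idempotent_in_units_at) (auto simp: units_at_def)

lemma subgroup_of_units_at:
  assumes "e \<in> idempotents S"
  shows "subgroup_of S (units_at e)"
  unfolding subgroup_of_def
proof
  show "units_at e \<subseteq> carrier S" by (auto simp: units_at_def)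
  let ?G = "group_on S (units_at e)"
  have c: "carrier ?G = units_at e" and m: "mult ?G = sgmult S"
    by (simp_all add: group_on_def)
  show "group ?G"
  proof (rule groupI, unfold c m one_units_at[OF assms])
    show "\<exists>y\<in>units_at e. y \<cdot> x = e" if "x \<in> units_at e" for x
      using that unfolding units_at_def by blast
    show "x \<cdot> y \<in> units_at e" if "x \<in> units_at e" "y \<in> units_at e" for x y
      using mult_in_units_at assms that by blast
    show "e \<in> units_at e" using idempotent_in_units_at assms by blast
  qed (auto simp: units_at_def assoc)
qed

text \<open>The identity of a subgroup is an idempotent of \<open>S\<close>, and the group inverses
  are the witnesses that \<open>units_at\<close> asks for.\<close>

lemma subgroup_subset_units_at:
  assumes "subgroup_of S H"
  obtains e where "e \<in> idempotents S" "H \<subseteq> units_at e"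
proof
  let ?G = "group_on S H"
  interpret group ?G using assms by (simp add: subgroup_of_def)
  have c: "carrier ?G = H" and m: "mult ?G = sgmult S"
    by (simp_all add: group_on_def)
  have H: "H \<subseteq> carrier S" using assms by (simp add: subgroup_of_def)
  note G = one_closed[unfolded c] l_one[unfolded c m] r_one[unfolded c m]
    inv_closed[unfolded c] l_inv[unfolded c m] r_inv[unfolded c m]
  show "\<one>\<^bsub>?G\<^esub> \<in> idempotents S"
    using H G(1) G(2)[OF G(1)] by (auto simp: idempotents_def)
  show "H \<subseteq> units_at \<one>\<^bsub>?G\<^esub>"
  proof
    fix x assume x: "x \<in> H"
    define y where "y = inv\<^bsub>?G\<^esub> x"
    have "x \<in> carrier S" "y \<in> carrier S"
      using H x G(4)[OF x] by (auto simp: y_def)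
    moreover have "x \<cdot> y = \<one>\<^bsub>?G\<^esub>" "y \<cdot> x = \<one>\<^bsub>?G\<^esub>"
      unfolding y_def by (rule G(6)[OF x] G(5)[OF x])+
    moreover have "\<one>\<^bsub>?G\<^esub> \<cdot> y = y" "y \<cdot> \<one>\<^bsub>?G\<^esub> = y"
      unfolding y_def by (rule G(2,3)[OF G(4)[OF x]])+
    ultimately show "x \<in> units_at \<one>\<^bsub>?G\<^esub>"
      unfolding units_at_def using G(2,3)[OF x] by blast
  qed
qed

text \<open>With \<open>y \<cdot> x = e\<close> and \<open>x \<cdot> z = f\<close>, the equation
  \<open>x \<cdot> f = x\<close> gives \<open>e \<cdot> f = e\<close>, and
  \<open>e \<cdot> x = x\<close> gives \<open>e \<cdot> f = f\<close>. So groups of units at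
  distinct idempotents are disjoint, and the greatest subgroup containing a given unit
  exists.\<close>

lemma units_at_unique:
  assumes "x \<in> units_at e" "x \<in> units_at f"
    and "e \<in> idempotents S" "f \<in> idempotents S"
  shows "e = f"
proof -
  have C: "e \<in> carrier S" "f \<in> carrier S" "x \<in> carrier S"
    using assms by (auto simp: idempotents_def units_at_def)
  have x: "e \<cdot> x = x" "x \<cdot> f = x" using assms by (auto simp: units_at_def)
  obtain y where y: "y \<in> carrier S" "y \<cdot> x = e"
    using assms by (auto simp: units_at_def)
  obtain z where z: "z \<in> carrier S" "x \<cdot> z = f"
    using assms by (auto simp: units_at_def)
  have "e = e \<cdot> f" using assoc[of y x f] C x y by simp
  also have "\<dots> = f" using assoc[of e x z] C x z by simp
  finally show ?thesis .
qed

lemma maximal_subgroup_eq: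
  assumes "e \<in> idempotents S" "a \<in> units_at e"
  shows "maximal_subgroup S a = units_at e"
  unfolding maximal_subgroup_def
proof (rule Greatest_equality)
  show "subgroup_of S (units_at e) \<and> a \<in> units_at e"
    using assms subgroup_of_units_at by blast
next
  fix H assume H: "subgroup_of S H \<and> a \<in> H"
  then obtain f where f: "f \<in> idempotents S" "H \<subseteq> units_at f"
    using subgroup_subset_units_at by metis
  then have "f = e" using assms H units_at_unique by blast
  then show "H \<subseteq> units_at e" using f by simp
qed

text \<open>An inverse that commutes with \<open>a\<close> is a group inverse:
  \<open>a \<cdot> x\<close> is the identity, and \<open>a\<close> and \<open>x\<close> witness each
  other's invertibility.\<close>

lemma commuting_inverse_units:
  assumes "a \<in> carrier S" "x \<in> carrier S" "a \<cdot> x \<cdot> a = a" "x \<cdot> a \<cdot> x = x" "a \<cdot> x = x \<cdot> a"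
  shows "a \<cdot> x \<in> idempotents S" "a \<in> units_at (a \<cdot> x)" "x \<in> units_at (a \<cdot> x)"
proof -
  have "(a \<cdot> x) \<cdot> (a \<cdot> x) = (a \<cdot> x \<cdot> a) \<cdot> x"
    using assms(1,2) by (simp add: assoc closed)
  then show "a \<cdot> x \<in> idempotents S"
    using assms by (simp add: idempotents_def closed)
  have *: "(a \<cdot> x) \<cdot> a = a" "(a \<cdot> x) \<cdot> x = x" using assms by simp_all
  have "a \<cdot> (a \<cdot> x) = a \<cdot> x \<cdot> a" "x \<cdot> (a \<cdot> x) = x \<cdot> a \<cdot> x"
    by (metis assms(1,2,5) assoc)+
  then show "a \<in> units_at (a \<cdot> x)" "x \<in> units_at (a \<cdot> x)"
    unfolding units_at_def using assms * by auto
qed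

text \<open>The bridge from maximal subgroups to equations: a commuting inverse lies in the same
  group of units, where inverses are unique.\<close>

lemma cr_inv_eqI:
  assumes "a \<in> carrier S" "x \<in> carrier S" "a \<cdot> x \<cdot> a = a" "x \<cdot> a \<cdot> x = x" "a \<cdot> x = x \<cdot> a"
  shows "cr_inv S a = x"
proof -
  note u = commuting_inverse_units[OF assms]
  let ?G = "group_on S (units_at (a \<cdot> x))"
  interpret group ?G
    using subgroup_of_units_at[OF u(1)] by (simp add: subgroup_of_def)
  have c: "carrier ?G = units_at (a \<cdot> x)" and m: "mult ?G = sgmult S"
    by (simp_all add: group_on_def)
  have "inv\<^bsub>?G\<^esub> a = x"
    by (rule inv_equality, unfold c m one_units_at[OF u(1)]) (use u assms in auto)
  then show ?thesis
    using maximal_subgroup_eq[OF u(1,2)] by (simp add: cr_inv_def)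
qed

lemma completely_regularI:
  assumes "\<And>a. a \<in> carrier S \<Longrightarrow>
    \<exists>x\<in>carrier S. a \<cdot> x \<cdot> a = a \<and> x \<cdot> a \<cdot> x = x \<and> a \<cdot> x = x \<cdot> a"
  shows "completely_regular S"
proof -
  have "\<exists>H. subgroup_of S H \<and> a \<in> H" if "a \<in> carrier S" for a
    using assms[OF that] commuting_inverse_units that subgroup_of_units_at by metis
  then have "carrier S = \<Union>{H. subgroup_of S H}"
    by (auto simp: subgroup_of_def)
  then show ?thesis
    using semigrp_axioms by (simp add: completely_regular_def)
qed

end


subsection \<open>Arithmetic in completely regular semigroups\<close>

locale cr_semigrp = semigrp +
  assumes cr: "completely_regular S"
begin

abbreviation inv_cr ("_\<^sup>-" [1000] 1000) where "a\<^sup>- \<equiv> cr_inv S a"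
abbreviation zero_cr ("_\<degree>" [1000] 1000) where "a\<degree> \<equiv> cr_zero S a"

lemma commuting_inverse_exists:
  assumes "a \<in> carrier S"
  obtains x where "x \<in> carrier S" "a \<cdot> x \<cdot> a = a" "x \<cdot> a \<cdot> x = x" "a \<cdot> x = x \<cdot> a"
proof -
  obtain H where H: "subgroup_of S H" "a \<in> H"
    using cr assms unfolding completely_regular_def by blast
  obtain e where "e \<in> idempotents S" "H \<subseteq> units_at e"
    using subgroup_subset_units_at H by blast
  then have "a \<in> units_at e" using H by blast
  then obtain x where "x \<in> carrier S" "e \<cdot> a = a" "e \<cdot> x = x" "a \<cdot> x = e" "x \<cdot> a = e"
    unfolding units_at_def by blast
  then show ?thesis using that by simp
qed

lemma
  assumes a: "a \<in> carrier S"
  shows inv_closed: "a\<^sup>- \<in> carrier S"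
    and mult_inv_mult: "a \<cdot> a\<^sup>- \<cdot> a = a"
    and inv_mult_inv: "a\<^sup>- \<cdot> a \<cdot> a\<^sup>- = a\<^sup>-"
    and mult_inv: "a \<cdot> a\<^sup>- = a\<degree>"
    and inv_mult: "a\<^sup>- \<cdot> a = a\<degree>"
proof -
  obtain x where x: "x \<in> carrier S" "a \<cdot> x \<cdot> a = a" "x \<cdot> a \<cdot> x = x" "a \<cdot> x = x \<cdot> a"
    using commuting_inverse_exists[OF a] .
  then have "a\<^sup>- = x" by (intro cr_inv_eqI a)
  then show "a\<^sup>- \<in> carrier S" "a \<cdot> a\<^sup>- \<cdot> a = a" "a\<^sup>- \<cdot> a \<cdot> a\<^sup>- = a\<^sup>-"
    "a \<cdot> a\<^sup>- = a\<degree>" "a\<^sup>- \<cdot> a = a\<degree>"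
    using x by (auto simp: cr_zero_def)
qed

lemma
  assumes a: "a \<in> carrier S"
  shows zero_closed: "a\<degree> \<in> carrier S"
    and zero_mult: "a\<degree> \<cdot> a = a"
    and mult_zero: "a \<cdot> a\<degree> = a"
    and zero_mult_inv: "a\<degree> \<cdot> a\<^sup>- = a\<^sup>-"
    and inv_mult_zero: "a\<^sup>- \<cdot> a\<degree> = a\<^sup>-"
proof -
  note i = inv_closed[OF a]
  show "a\<degree> \<in> carrier S" using closed[OF a i] mult_inv[OF a] by simp
  show "a\<degree> \<cdot> a = a" using mult_inv[OF a] mult_inv_mult[OF a] by simp
  show "a\<degree> \<cdot> a\<^sup>- = a\<^sup>-" using inv_mult[OF a] inv_mult_inv[OF a] by simp
  show "a \<cdot> a\<degree> = a" "a\<^sup>- \<cdot> a\<degree> = a\<^sup>-"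
    using assoc[OF a i a] assoc[OF i a i] mult_inv_mult[OF a] inv_mult_inv[OF a]
    by (simp_all add: mult_inv[OF a] inv_mult[OF a])
qed

lemma zero_idem: "a \<in> carrier S \<Longrightarrow> a\<degree> \<cdot> a\<degree> = a\<degree>"
  using assoc[of "a\<degree>" a "a\<^sup>-"] by (simp add: zero_closed inv_closed zero_mult mult_inv)

lemma zero_idempotent: "a \<in> carrier S \<Longrightarrow> a\<degree> \<in> idempotents S"
  by (simp add: idempotents_def zero_closed zero_idem)

lemma idemD: "e \<in> idempotents S \<Longrightarrow> e \<in> carrier S" "e \<in> idempotents S \<Longrightarrow> e \<cdot> e = e"
  by (auto simp: idempotents_def)

lemma inv_idempotent: "e \<in> idempotents S \<Longrightarrow> e\<^sup>- = e"
  by (rule cr_inv_eqI) (auto simp: idempotents_def)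

lemma zero_of_idempotent: "e \<in> idempotents S \<Longrightarrow> e\<degree> = e"
  using inv_idempotent[of e] mult_inv[of e] by (simp add: idempotents_def)

lemma zero_zero: "a \<in> carrier S \<Longrightarrow> a\<degree>\<degree> = a\<degree>"
  by (simp add: zero_idempotent zero_of_idempotent)

text \<open>The hypotheses make \<open>x\<close> a commuting inverse of \<open>a\<close>, so
  \<open>x\<close> is \<open>a\<^sup>-\<close>.\<close>

lemma zero_eqI:
  assumes "a \<in> carrier S" "x \<in> carrier S" "a \<cdot> x = e" "x \<cdot> a = e" "e \<cdot> a = a" "e \<cdot> x = x"
  shows "a\<degree> = e"
proof -
  have "a\<^sup>- = x" using assms by (intro cr_inv_eqI) auto
  then show ?thesis using assms mult_inv by metis
qed

lemma zero_left_absorb: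
  assumes "a \<in> carrier S" "e \<in> carrier S" "e \<cdot> a = a"
  shows "e \<cdot> a\<degree> = a\<degree>"
  using assoc[of e a "a\<^sup>-"] assms by (simp add: inv_closed mult_inv)

lemma zero_right_absorb:
  assumes "a \<in> carrier S" "e \<in> carrier S" "a \<cdot> e = a"
  shows "a\<degree> \<cdot> e = a\<degree>"
  using assoc[of "a\<^sup>-" a e] assms by (simp add: inv_closed inv_mult)

lemma zero_mult_left:
  assumes "a \<in> carrier S" "b \<in> carrier S"
  shows "a\<degree> \<cdot> (a \<cdot> b)\<degree> = (a \<cdot> b)\<degree>"
  using assms by (intro zero_left_absorb) (simp_all add: closed zero_closed zero_mult flip: assoc)

lemma zero_mult_right:
  assumes "a \<in> carrier S" "b \<in> carrier S"
  shows "(a \<cdot> b)\<degree> \<cdot> b\<degree> = (a \<cdot> b)\<degree>"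
  using assms by (intro zero_right_absorb) (simp_all add: closed zero_closed mult_zero assoc)

text \<open>\<open>a\<^sup>- \<cdot> a\<^sup>-\<close> inverts \<open>a \<cdot> a\<close> with the
  same identity \<open>a\<degree>\<close>.\<close>

lemma zero_square: "a \<in> carrier S \<Longrightarrow> (a \<cdot> a)\<degree> = a\<degree>"
proof -
  assume a: "a \<in> carrier S"
  note C = a inv_closed[OF a] zero_closed[OF a]
  have "a \<cdot> a \<cdot> (a\<^sup>- \<cdot> a\<^sup>-) = a \<cdot> ((a \<cdot> a\<^sup>-) \<cdot> a\<^sup>-)"
    "a\<^sup>- \<cdot> a\<^sup>- \<cdot> (a \<cdot> a) = a\<^sup>- \<cdot> ((a\<^sup>- \<cdot> a) \<cdot> a)"
    using C by (simp_all add: assoc closed)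
  then have "a \<cdot> a \<cdot> (a\<^sup>- \<cdot> a\<^sup>-) = a\<degree>" "a\<^sup>- \<cdot> a\<^sup>- \<cdot> (a \<cdot> a) = a\<degree>"
    using C by (simp_all add: mult_inv inv_mult zero_mult zero_mult_inv)
  then show ?thesis
    using C by (intro zero_eqI[of _ "a\<^sup>- \<cdot> a\<^sup>-"])
      (simp_all add: closed zero_mult zero_mult_inv flip: assoc)
qed

section \<open>Green's relations expressed through \<open>a\<degree>\<close>\<close>

lemma green_L_iff:
  assumes "a \<in> carrier S" "b \<in> carrier S"
  shows "(a, b) \<in> green_L S \<longleftrightarrow> a \<cdot> b\<degree> = a \<and> b \<cdot> a\<degree> = b"
proof -
  \<comment> \<open>Membership in a principal left ideal becomes an equation:
    \<open>a \<cdot> b\<degree> = a\<close> yields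
    \<open>a = (a \<cdot> b\<^sup>-) \<cdot> b\<close>.\<close>
  have *: "a \<in> insert b ((\<lambda>x. x \<cdot> b) ` carrier S) \<longleftrightarrow> a \<cdot> b\<degree> = a"
    if "a \<in> carrier S" "b \<in> carrier S" for a b
  proof
    assume "a \<in> insert b ((\<lambda>x. x \<cdot> b) ` carrier S)"
    then show "a \<cdot> b\<degree> = a" using that by (auto simp: mult_zero assoc zero_closed)
  next
    assume "a \<cdot> b\<degree> = a"
    then have "a = (a \<cdot> b\<^sup>-) \<cdot> b" using that by (simp add: assoc inv_closed inv_mult)
    then show "a \<in> insert b ((\<lambda>x. x \<cdot> b) ` carrier S)"
      using that closed inv_closed by blast
  qed
  \<comment> \<open>Left multiples of \<open>a\<close> inherit the equation of \<open>a\<close>, so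
    membership of the generator already gives inclusion of the ideals.\<close>
  have **: "insert a ((\<lambda>x. x \<cdot> a) ` carrier S) \<subseteq> insert b ((\<lambda>x. x \<cdot> b) ` carrier S)"
    if "a \<in> carrier S" "b \<in> carrier S" "a \<cdot> b\<degree> = a" for a b
  proof -
    have "c \<in> carrier S \<Longrightarrow> c \<cdot> a \<in> insert b ((\<lambda>x. x \<cdot> b) ` carrier S)" for c
      using that *[of "c \<cdot> a" b] by (simp add: closed assoc zero_closed)
    then show ?thesis using *[of a b] that by blast
  qed
  show ?thesis
    unfolding green_L_def using assms *[of a b] *[of b a] **[of a b] **[of b a] by auto
qed

lemma green_R_iff:
  assumes "a \<in> carrier S" "b \<in> carrier S"
  shows "(a, b) \<in> green_R S \<longleftrightarrow> b\<degree> \<cdot> a = a \<and> a\<degree> \<cdot> b = b"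
proof -
  have *: "a \<in> insert b ((\<lambda>x. b \<cdot> x) ` carrier S) \<longleftrightarrow> b\<degree> \<cdot> a = a"
    if "a \<in> carrier S" "b \<in> carrier S" for a b
  proof
    assume "a \<in> insert b ((\<lambda>x. b \<cdot> x) ` carrier S)"
    then show "b\<degree> \<cdot> a = a" using that by (auto simp: zero_mult zero_closed simp flip: assoc)
  next
    assume "b\<degree> \<cdot> a = a"
    then have "a = b \<cdot> (b\<^sup>- \<cdot> a)" using that by (simp add: inv_closed mult_inv flip: assoc)
    then show "a \<in> insert b ((\<lambda>x. b \<cdot> x) ` carrier S)"
      using that closed inv_closed by blast
  qed
  have **: "insert a ((\<lambda>x. a \<cdot> x) ` carrier S) \<subseteq> insert b ((\<lambda>x. b \<cdot> x) ` carrier S)"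
    if "a \<in> carrier S" "b \<in> carrier S" "b\<degree> \<cdot> a = a" for a b
  proof -
    have "c \<in> carrier S \<Longrightarrow> a \<cdot> c \<in> insert b ((\<lambda>x. b \<cdot> x) ` carrier S)" for c
      using that *[of "a \<cdot> c" b] by (simp add: closed zero_closed flip: assoc)
    then show ?thesis using *[of a b] that by blast
  qed
  show ?thesis
    unfolding green_R_def using assms *[of a b] *[of b a] **[of a b] **[of b a] by auto
qed

text \<open>If \<open>a \<cdot> b\<degree> = a\<close> and \<open>a\<degree> \<cdot> b = b\<close>,
  then \<open>a\<degree> \<cdot> b\<degree>\<close> equals both \<open>a\<degree>\<close> and
  \<open>b\<degree>\<close>.\<close>

lemma green_H_eq: "green_H S = {(a, b) \<in> carrier S \<times> carrier S. a\<degree> = b\<degree>}"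
proof -
  have "(a, b) \<in> green_H S \<longleftrightarrow> a\<degree> = b\<degree>" if C: "a \<in> carrier S" "b \<in> carrier S" for a b
  proof
    assume "(a, b) \<in> green_H S"
    then have "a \<cdot> b\<degree> = a" "a\<degree> \<cdot> b = b"
      using C by (auto simp: green_H_def green_L_iff green_R_iff)
    then show "a\<degree> = b\<degree>"
      using zero_right_absorb[of a "b\<degree>"] zero_left_absorb[of b "a\<degree>"] C zero_closed by simp
  next
    assume *: "a\<degree> = b\<degree>"
    then show "(a, b) \<in> green_H S"
      using zero_mult[OF C(1)] mult_zero[OF C(1)] zero_mult[OF C(2)] mult_zero[OF C(2)]
      by (simp add: green_H_def green_L_iff[OF C] green_R_iff[OF C])
  qed
  moreover have "green_H S \<subseteq> carrier S \<times> carrier S"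
    by (auto simp: green_H_def green_L_def)
  ultimately show ?thesis by auto
qed

text \<open>Since H is the kernel of the map sending \<open>a\<close> to \<open>a\<degree>\<close>,
  it is a congruence exactly when \<open>(a \<cdot> b)\<degree>\<close> depends only on
  \<open>a\<degree>\<close> and \<open>b\<degree>\<close>, which serve as canonical representatives.
  The equational form is what can be tested in quotients.\<close>

lemma cryptogroup_iff:
  "cryptogroup S \<longleftrightarrow>
     (\<forall>a\<in>carrier S. \<forall>b\<in>carrier S. (a \<cdot> b)\<degree> = (a\<degree> \<cdot> b\<degree>)\<degree>)" (is "?L \<longleftrightarrow> ?R")
proof
  assume ?L
  then have H: "congruence S (green_H S)" by (simp add: cryptogroup_def)
  show ?R
  proof (intro ballI)
    fix a b assume C: "a \<in> carrier S" "b \<in> carrier S"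
    have "(a, a\<degree>) \<in> green_H S" "(b, b\<degree>) \<in> green_H S"
      using C by (auto simp: green_H_eq zero_closed zero_zero)
    then have "(a \<cdot> b, a\<degree> \<cdot> b) \<in> green_H S" "(a\<degree> \<cdot> b, a\<degree> \<cdot> b\<degree>) \<in> green_H S"
      using H C unfolding congruence_def by (blast intro: zero_closed)+
    then show "(a \<cdot> b)\<degree> = (a\<degree> \<cdot> b\<degree>)\<degree>" by (auto simp: green_H_eq)
  qed
next
  assume R: ?R
  have "equiv (carrier S) (green_H S)"
    unfolding green_H_eq by (rule equivI) (auto simp: refl_on_def sym_def trans_def)
  moreover have "(c \<cdot> a, c \<cdot> b) \<in> green_H S \<and> (a \<cdot> c, b \<cdot> c) \<in> green_H S"
    if "(a, b) \<in> green_H S" "c \<in> carrier S" for a b c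
    using that R by (auto simp: green_H_eq closed)
  ultimately show ?L
    using cr unfolding cryptogroup_def congruence_def by blast
qed


end


subsection \<open>Congruences and quotients\<close>

context semigrp
begin

lemma congruence_equiv: "congruence S \<rho> \<Longrightarrow> equiv (carrier S) \<rho>"
  by (simp add: congruence_def)

lemma
  assumes "congruence S \<rho>"
  shows congruence_subset: "\<rho> \<subseteq> carrier S \<times> carrier S"
    and congruence_refl: "a \<in> carrier S \<Longrightarrow> (a, a) \<in> \<rho>"
    and congruence_sym: "(a, b) \<in> \<rho> \<Longrightarrow> (b, a) \<in> \<rho>"
    and congruence_trans: "(a, b) \<in> \<rho> \<Longrightarrow> (b, c) \<in> \<rho> \<Longrightarrow> (a, c) \<in> \<rho>"
  using congruence_equiv[OF assms] unfolding equiv_def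
  by (blast dest: refl_onD symD transD)+

lemma congruence_mult:
  assumes "congruence S \<rho>" "(a, b) \<in> \<rho>" "(c, d) \<in> \<rho>"
  shows "(a \<cdot> c, b \<cdot> d) \<in> \<rho>"
proof -
  have "c \<in> carrier S" "b \<in> carrier S" using congruence_subset assms by blast+
  then have "(a \<cdot> c, b \<cdot> c) \<in> \<rho>" "(b \<cdot> c, b \<cdot> d) \<in> \<rho>"
    using assms unfolding congruence_def by blast+
  then show ?thesis using congruence_trans assms by blast
qed

lemma congruenceI:
  assumes "\<rho> \<subseteq> carrier S \<times> carrier S"
    and "\<And>a. a \<in> carrier S \<Longrightarrow> (a, a) \<in> \<rho>"
    and "\<And>a b. (a, b) \<in> \<rho> \<Longrightarrow> (b, a) \<in> \<rho>"
    and "\<And>a b c. (a, b) \<in> \<rho> \<Longrightarrow> (b, c) \<in> \<rho> \<Longrightarrow> (a, c) \<in> \<rho>"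
    and "\<And>a b c. (a, b) \<in> \<rho> \<Longrightarrow> c \<in> carrier S \<Longrightarrow> (c \<cdot> a, c \<cdot> b) \<in> \<rho>"
    and "\<And>a b c. (a, b) \<in> \<rho> \<Longrightarrow> c \<in> carrier S \<Longrightarrow> (a \<cdot> c, b \<cdot> c) \<in> \<rho>"
  shows "congruence S \<rho>"
proof -
  have "equiv (carrier S) \<rho>"
    using assms(1-4) by (intro equivI refl_onI symI transI) blast+
  then show ?thesis unfolding congruence_def using assms(5,6) by blast
qed

lemma congruence_Inter:
  assumes "A \<noteq> {}" "\<And>\<rho>. \<rho> \<in> A \<Longrightarrow> congruence S \<rho>"
  shows "congruence S (\<Inter>A)"
proof (rule congruenceI)
  show "\<Inter>A \<subseteq> carrier S \<times> carrier S" using assms congruence_subset by blast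
  show "(a, c) \<in> \<Inter>A" if "(a, b) \<in> \<Inter>A" "(b, c) \<in> \<Inter>A" for a b c
    using assms(2) that congruence_trans by blast
  show "(c \<cdot> a, c \<cdot> b) \<in> \<Inter>A" "(a \<cdot> c, b \<cdot> c) \<in> \<Inter>A"
    if "(a, b) \<in> \<Inter>A" "c \<in> carrier S" for a b c
    using assms(2) that congruence_mult congruence_refl by (simp_all add: InterI)
qed (use assms congruence_sym congruence_refl in blast)+

lemma congruence_Int:
  assumes "congruence S \<rho>" "congruence S \<sigma>"
  shows "congruence S (\<rho> \<inter> \<sigma>)"
  using congruence_Inter[of "{\<rho>, \<sigma>}"] assms by auto

lemma congruence_Id_on: "congruence S (Id_on (carrier S))"
  by (rule congruenceI) (auto simp: closed)

lemma Least_Inter: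
  assumes "P (\<Inter>{\<rho>. P \<rho>})"
  shows "(LEAST \<rho>. P \<rho>) = \<Inter>{\<rho>. P \<rho>}"
  using assms by (intro Least_equality) auto

text \<open>Common source of \<open>beta\<close> and \<open>kappa\<close>: the congruences
  containing given pairs are closed under intersection, and the universal relation shows that there
  is one.\<close>

lemma least_congruence:
  assumes P: "\<And>\<rho>. P \<rho> \<longleftrightarrow> congruence S \<rho> \<and> X \<subseteq> \<rho>"
    and X: "X \<subseteq> carrier S \<times> carrier S"
  shows "P (LEAST \<rho>. P \<rho>)" and "P \<sigma> \<Longrightarrow> (LEAST \<rho>. P \<rho>) \<subseteq> \<sigma>"
proof -
  have "congruence S (carrier S \<times> carrier S)"
    by (rule congruenceI) (auto simp: closed)
  then have "P (carrier S \<times> carrier S)" using P X by blast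
  then have "congruence S (\<Inter>{\<rho>. P \<rho>})"
    using P by (intro congruence_Inter) blast+
  moreover have "X \<subseteq> \<Inter>{\<rho>. P \<rho>}" using P by blast
  ultimately have "P (\<Inter>{\<rho>. P \<rho>})" using P by blast
  then have eq: "(LEAST \<rho>. P \<rho>) = \<Inter>{\<rho>. P \<rho>}" and "P (\<Inter>{\<rho>. P \<rho>})"
    using Least_Inter[of P] by blast+
  then show "P (LEAST \<rho>. P \<rho>)" "P \<sigma> \<Longrightarrow> (LEAST \<rho>. P \<rho>) \<subseteq> \<sigma>"
    by simp_all blast
qed

lemma class_eq_iff:
  assumes "congruence S \<rho>" "a \<in> carrier S" "b \<in> carrier S"
  shows "\<rho> `` {a} = \<rho> `` {b} \<longleftrightarrow> (a, b) \<in> \<rho>"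
  using eq_equiv_class_iff[OF congruence_equiv] assms by blast

lemma quotient_carrier: "carrier (quotient_semigrp S \<rho>) = (\<lambda>a. \<rho> `` {a}) ` carrier S"
  by (auto simp: quotient_semigrp_def quotient_def)

lemma quotient_mult:
  assumes \<rho>: "congruence S \<rho>" and C: "a \<in> carrier S" "b \<in> carrier S"
  shows "(\<rho> `` {a}) \<cdot>\<^bsub>quotient_semigrp S \<rho>\<^esub> (\<rho> `` {b}) = \<rho> `` {a \<cdot> b}"
proof -
  have "a \<cdot> b \<in> {x \<cdot> y | x y. x \<in> \<rho> `` {a} \<and> y \<in> \<rho> `` {b}}"
    using congruence_refl[OF \<rho>] C by blast
  moreover have "(a \<cdot> b, z) \<in> \<rho>" if "z \<in> {x \<cdot> y | x y. x \<in> \<rho> `` {a} \<and> y \<in> \<rho> `` {b}}" for z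
    using that congruence_mult[OF \<rho>] by auto
  ultimately show ?thesis
    unfolding quotient_semigrp_def using congruence_trans[OF \<rho>] by auto
qed

lemma semigrp_quotient:
  assumes "congruence S \<rho>"
  shows "semigrp (quotient_semigrp S \<rho>)"
  by unfold_locales (auto simp: quotient_carrier quotient_mult[OF assms] closed assoc)

end

section \<open>Quotients of completely regular semigroups\<close>

context cr_semigrp
begin

text \<open>The class of \<open>a\<^sup>-\<close> is a commuting inverse of the class of
  \<open>a\<close>, so both claims follow from the equational criteria.\<close>

lemma
  assumes \<rho>: "congruence S \<rho>"
  shows cr_quotient: "cr_semigrp (quotient_semigrp S \<rho>)"
    and quotient_inv: "a \<in> carrier S \<Longrightarrow> cr_inv (quotient_semigrp S \<rho>) (\<rho> `` {a}) = \<rho> `` {a\<^sup>-}"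
proof -
  let ?Q = "quotient_semigrp S \<rho>"
  interpret Q: semigrp ?Q using semigrp_quotient[OF \<rho>] .
  have *: "\<rho> `` {a\<^sup>-} \<in> carrier ?Q"
    "\<rho> `` {a} \<cdot>\<^bsub>?Q\<^esub> \<rho> `` {a\<^sup>-} \<cdot>\<^bsub>?Q\<^esub> \<rho> `` {a} = \<rho> `` {a}"
    "\<rho> `` {a\<^sup>-} \<cdot>\<^bsub>?Q\<^esub> \<rho> `` {a} \<cdot>\<^bsub>?Q\<^esub> \<rho> `` {a\<^sup>-} = \<rho> `` {a\<^sup>-}"
    "\<rho> `` {a} \<cdot>\<^bsub>?Q\<^esub> \<rho> `` {a\<^sup>-} = \<rho> `` {a\<^sup>-} \<cdot>\<^bsub>?Q\<^esub> \<rho> `` {a}"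
    if "a \<in> carrier S" for a
    using that by (simp_all add: quotient_mult[OF \<rho>] quotient_carrier inv_closed closed
        mult_inv_mult inv_mult_inv) (simp add: mult_inv inv_mult)
  have "completely_regular ?Q"
  proof (rule Q.completely_regularI)
    fix A assume "A \<in> carrier ?Q"
    then obtain a where a: "a \<in> carrier S" and A: "A = \<rho> `` {a}"
      by (auto simp: quotient_carrier)
    show "\<exists>x\<in>carrier ?Q. A \<cdot>\<^bsub>?Q\<^esub> x \<cdot>\<^bsub>?Q\<^esub> A = A \<and> x \<cdot>\<^bsub>?Q\<^esub> A \<cdot>\<^bsub>?Q\<^esub> x = x \<and> A \<cdot>\<^bsub>?Q\<^esub> x = x \<cdot>\<^bsub>?Q\<^esub> A"
      using *[OF a] unfolding A by blast
  qed
  then show "cr_semigrp ?Q" by unfold_locales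
  show "cr_inv ?Q (\<rho> `` {a}) = \<rho> `` {a\<^sup>-}" if "a \<in> carrier S"
    using *[OF that] that by (intro Q.cr_inv_eqI) (auto simp: quotient_carrier)
qed

lemma quotient_zero:
  assumes "congruence S \<rho>" "a \<in> carrier S"
  shows "cr_zero (quotient_semigrp S \<rho>) (\<rho> `` {a}) = \<rho> `` {a\<degree>}"
  using assms by (simp add: cr_zero_def[of "quotient_semigrp S \<rho>"] quotient_inv quotient_mult
      inv_closed mult_inv)

text \<open>Read in the quotient: equal classes have equal inverses.\<close>

lemma congruence_inv:
  assumes \<rho>: "congruence S \<rho>" and "(a, b) \<in> \<rho>"
  shows "(a\<^sup>-, b\<^sup>-) \<in> \<rho>"
proof -
  have C: "a \<in> carrier S" "b \<in> carrier S" using congruence_subset assms by blast+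
  then show ?thesis
    using assms class_eq_iff[OF \<rho>] quotient_inv[OF \<rho>] inv_closed by metis
qed

lemma congruence_zero:
  assumes \<rho>: "congruence S \<rho>" and "(a, b) \<in> \<rho>"
  shows "(a\<degree>, b\<degree>) \<in> \<rho>"
  using congruence_mult[OF \<rho> assms(2) congruence_inv[OF assms]] congruence_subset[OF \<rho>] assms(2)
  by (auto simp: mult_inv)

text \<open>From \<open>a\<close> related to \<open>e\<close> follows \<open>a\<degree>\<close>
  related to \<open>e\<degree> = e\<close>. Kernel and idempotent purity can therefore be tested on
  the single pair of \<open>a\<close> and \<open>a\<degree>\<close>.\<close>

lemma congruence_idempotent_zero:
  assumes "congruence S \<rho>" "(a, e) \<in> \<rho>" "e \<in> idempotents S"
  shows "(a, a\<degree>) \<in> \<rho>"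
proof -
  have "(a\<degree>, e) \<in> \<rho>" using congruence_zero assms zero_of_idempotent by metis
  then show ?thesis using congruence_trans congruence_sym assms by blast
qed

lemma kern_eq:
  assumes "congruence S \<rho>"
  shows "kern S \<rho> = {a \<in> carrier S. (a, a\<degree>) \<in> \<rho>}"
  unfolding kern_def using congruence_idempotent_zero[OF assms] zero_idempotent by blast

lemma idempotent_pure_iff:
  assumes "congruence S \<rho>"
  shows "idempotent_pure S \<rho> \<longleftrightarrow> (\<forall>a\<in>carrier S. (a, a\<degree>) \<in> \<rho> \<longrightarrow> a \<in> idempotents S)"
  unfolding idempotent_pure_def
  using congruence_idempotent_zero[OF assms] zero_idempotent by blast

text \<open>The condition is put as inclusion of a set of pairs so that
  \<open>least_congruence\<close> applies.\<close>

lemma band_congruence_iff: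
  "band_congruence S \<rho> \<longleftrightarrow> congruence S \<rho> \<and> (\<lambda>a. (a, a \<cdot> a)) ` carrier S \<subseteq> \<rho>"
proof (cases "congruence S \<rho>")
  case True
  have "band (quotient_semigrp S \<rho>) \<longleftrightarrow> (\<forall>a\<in>carrier S. (a \<cdot> a, a) \<in> \<rho>)"
    using semigrp_quotient[OF True]
    by (simp add: band_def quotient_carrier quotient_mult[OF True] class_eq_iff[OF True] closed)
  then show ?thesis using True congruence_sym[OF True] unfolding band_congruence_def by blast
qed (simp add: band_congruence_def)

text \<open>This is \<open>cryptogroup_iff\<close> for the quotient, with equalities of classes
  pulled back to \<open>\<rho>\<close>.\<close>

lemma cryptogroup_congruence_iff:
  "cryptogroup_congruence S \<rho> \<longleftrightarrow> congruence S \<rho> \<and>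
     (\<lambda>(a, b). ((a \<cdot> b)\<degree>, (a\<degree> \<cdot> b\<degree>)\<degree>)) ` (carrier S \<times> carrier S) \<subseteq> \<rho>"
proof (cases "congruence S \<rho>")
  case True
  interpret Q: cr_semigrp "quotient_semigrp S \<rho>" using cr_quotient[OF True] .
  have "cryptogroup (quotient_semigrp S \<rho>) \<longleftrightarrow>
      (\<forall>a\<in>carrier S. \<forall>b\<in>carrier S. ((a \<cdot> b)\<degree>, (a\<degree> \<cdot> b\<degree>)\<degree>) \<in> \<rho>)"
    by (simp add: Q.cryptogroup_iff quotient_carrier quotient_mult[OF True]
        quotient_zero[OF True] class_eq_iff[OF True] closed zero_closed)
  then show ?thesis using True by (auto simp: cryptogroup_congruence_def)
qed (simp add: cryptogroup_congruence_def)

section \<open>The least band congruence and the least cryptogroup congruence\<close>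

lemma beta_band_congruence: "band_congruence S (beta S)"
  and beta_least: "band_congruence S \<rho> \<Longrightarrow> beta S \<subseteq> \<rho>"
proof -
  have "(\<lambda>a. (a, a \<cdot> a)) ` carrier S \<subseteq> carrier S \<times> carrier S" by (auto simp: closed)
  note least = least_congruence[of "band_congruence S", OF band_congruence_iff this]
  show "band_congruence S (beta S)" "band_congruence S \<rho> \<Longrightarrow> beta S \<subseteq> \<rho>"
    unfolding beta_def using least by simp_all
qed

lemma kappa_cryptogroup_congruence: "cryptogroup_congruence S (kappa S)"
  and kappa_least: "cryptogroup_congruence S \<rho> \<Longrightarrow> kappa S \<subseteq> \<rho>"
proof -
  have "(\<lambda>(a, b). ((a \<cdot> b)\<degree>, (a\<degree> \<cdot> b\<degree>)\<degree>)) ` (carrier S \<times> carrier S) \<subseteq> carrier S \<times> carrier S"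
    by (auto simp: closed zero_closed)
  note least = least_congruence[of "cryptogroup_congruence S", OF cryptogroup_congruence_iff this]
  show "cryptogroup_congruence S (kappa S)" "cryptogroup_congruence S \<rho> \<Longrightarrow> kappa S \<subseteq> \<rho>"
    unfolding kappa_def using least by simp_all
qed

lemma beta_congruence: "congruence S (beta S)"
  and kappa_congruence: "congruence S (kappa S)"
  using beta_band_congruence kappa_cryptogroup_congruence
  by (simp_all add: band_congruence_iff cryptogroup_congruence_iff)

text \<open>Multiply the pair of \<open>a\<close> and \<open>a \<cdot> a\<close> on the right by
  \<open>a\<^sup>-\<close>.\<close>

lemma band_congruence_zero:
  assumes "band_congruence S \<rho>" "a \<in> carrier S"
  shows "(a, a\<degree>) \<in> \<rho>"
proof -
  have \<rho>: "congruence S \<rho>" and sq: "(a, a \<cdot> a) \<in> \<rho>"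
    using assms by (auto simp: band_congruence_iff)
  have "(a \<cdot> a\<^sup>-, a \<cdot> a \<cdot> a\<^sup>-) \<in> \<rho>"
    using congruence_mult[OF \<rho> sq congruence_refl[OF \<rho> inv_closed]] assms(2) .
  then have "(a\<degree>, a) \<in> \<rho>" using assms(2) by (simp add: assoc inv_closed mult_inv mult_zero)
  then show ?thesis using congruence_sym[OF \<rho>] by blast
qed

lemma band_congruence_cryptogroup:
  assumes "band_congruence S \<rho>"
  shows "cryptogroup_congruence S \<rho>"
proof -
  have \<rho>: "congruence S \<rho>" using assms by (auto simp: band_congruence_iff)
  have "((a \<cdot> b)\<degree>, (a\<degree> \<cdot> b\<degree>)\<degree>) \<in> \<rho>" if "a \<in> carrier S" "b \<in> carrier S" for a b
    by (intro congruence_zero[OF \<rho>] congruence_mult[OF \<rho>] band_congruence_zero[OF assms] that)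
  then show ?thesis using \<rho> by (auto simp: cryptogroup_congruence_iff)
qed

lemma kappa_subset_beta: "kappa S \<subseteq> beta S"
  by (intro kappa_least band_congruence_cryptogroup beta_band_congruence)

text \<open>Modulo \<open>kappa S\<close>, the element \<open>(a \<cdot> b)\<degree>\<close> is
  determined by \<open>a\<degree>\<close> and \<open>b\<degree>\<close>, so the right side is a
  congruence; it contains the pairs of \<open>a\<close> and \<open>a \<cdot> a\<close> by
  \<open>zero_square\<close>. Conversely, \<open>beta S\<close> contains \<open>kappa S\<close> and
  relates every \<open>a\<close> to \<open>a\<degree>\<close>.\<close>

lemma beta_eq: "beta S = {(a, b) \<in> carrier S \<times> carrier S. (a\<degree>, b\<degree>) \<in> kappa S}" (is "_ = ?R")
proof
  note \<kappa> = kappa_congruence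
  have *: "((a \<cdot> b)\<degree>, (c \<cdot> d)\<degree>) \<in> kappa S"
    if "(a, c) \<in> ?R" "(b, d) \<in> ?R" for a b c d
  proof -
    have C: "a \<in> carrier S" "b \<in> carrier S" "c \<in> carrier S" "d \<in> carrier S" using that by auto
    have "((a \<cdot> b)\<degree>, (a\<degree> \<cdot> b\<degree>)\<degree>) \<in> kappa S" "((c \<cdot> d)\<degree>, (c\<degree> \<cdot> d\<degree>)\<degree>) \<in> kappa S"
      using kappa_cryptogroup_congruence C by (auto simp: cryptogroup_congruence_iff)
    moreover have "((a\<degree> \<cdot> b\<degree>)\<degree>, (c\<degree> \<cdot> d\<degree>)\<degree>) \<in> kappa S"
      using that by (intro congruence_zero[OF \<kappa>, of "_ \<cdot> _"] congruence_mult[OF \<kappa>]) simp_all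
    ultimately show ?thesis by (meson congruence_trans[OF \<kappa>] congruence_sym[OF \<kappa>])
  qed
  have refl: "(a, a) \<in> ?R" if "a \<in> carrier S" for a
    using congruence_refl[OF \<kappa>] that by (auto simp: zero_closed)
  have "congruence S ?R"
  proof (rule congruenceI)
    show "(c \<cdot> a, c \<cdot> b) \<in> ?R" "(a \<cdot> c, b \<cdot> c) \<in> ?R" if "(a, b) \<in> ?R" "c \<in> carrier S" for a b c
      using that *[OF that(1) refl[OF that(2)]] *[OF refl[OF that(2)] that(1)] by (auto simp: closed)
    show "(b, a) \<in> ?R" if "(a, b) \<in> ?R" for a b
      using that congruence_sym[OF \<kappa>] by simp
    show "(a, c) \<in> ?R" if "(a, b) \<in> ?R" "(b, c) \<in> ?R" for a b c
      using that congruence_trans[OF \<kappa>, of "a\<degree>" "b\<degree>" "c\<degree>"] by simp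
  qed (use refl in auto)
  moreover have "(a, a \<cdot> a) \<in> ?R" if "a \<in> carrier S" for a
    using that refl[OF that] by (simp add: closed zero_square)
  ultimately show "beta S \<subseteq> ?R"
    by (intro beta_least) (auto simp: band_congruence_iff)
  have "(a, b) \<in> beta S" if "(a, b) \<in> ?R" for a b
  proof -
    have "(a, a\<degree>) \<in> beta S" "(b, b\<degree>) \<in> beta S" "(a\<degree>, b\<degree>) \<in> beta S"
      using that band_congruence_zero[OF beta_band_congruence] kappa_subset_beta by auto
    then show ?thesis
      by (meson congruence_trans[OF beta_congruence] congruence_sym[OF beta_congruence])
  qed
  then show "?R \<subseteq> beta S" by auto
qed

lemma trace_beta: "trace S (beta S) = trace S (kappa S)"
  unfolding trace_def beta_eq using idemD zero_of_idempotent by auto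

section \<open>Kernels and idempotent pure congruences\<close>

lemma lower_k_least:
  assumes "congruence S \<rho>"
  shows "congruence S (lower_k S \<rho>)" "kern S (lower_k S \<rho>) = kern S \<rho>"
    and "congruence S \<sigma> \<Longrightarrow> kern S \<sigma> = kern S \<rho> \<Longrightarrow> lower_k S \<rho> \<subseteq> \<sigma>"
proof -
  let ?A = "{\<sigma>. congruence S \<sigma> \<and> kern S \<sigma> = kern S \<rho>}"
  have c: "congruence S (\<Inter>?A)" using assms by (intro congruence_Inter) auto
  \<comment> \<open>Testing the kernel on the pair of \<open>a\<close> and \<open>a\<degree>\<close>
    avoids an idempotent that varies with the congruence, so the kernel survives the
    intersection.\<close>
  have "a \<in> kern S (\<Inter>?A) \<longleftrightarrow> a \<in> kern S \<rho>" for a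
    unfolding kern_eq[OF c] using kern_eq assms by blast
  then have k: "kern S (\<Inter>?A) = kern S \<rho>" by blast
  have "lower_k S \<rho> = \<Inter>?A"
    unfolding lower_k_def using c k by (intro Least_Inter) auto
  then show "congruence S (lower_k S \<rho>)" "kern S (lower_k S \<rho>) = kern S \<rho>"
    "congruence S \<sigma> \<Longrightarrow> kern S \<sigma> = kern S \<rho> \<Longrightarrow> lower_k S \<rho> \<subseteq> \<sigma>"
    using c k by auto
qed

text \<open>Purity says that \<open>\<rho>\<close> has the same kernel as equality, and equality
  lies in every congruence.\<close>

lemma idempotent_pure_iff_lower_k:
  assumes "congruence S \<rho>"
  shows "idempotent_pure S \<rho> \<longleftrightarrow> lower_k S \<rho> = Id_on (carrier S)"
proof -
  have "kern S (Id_on (carrier S)) = idempotents S"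
    by (auto simp: kern_def idempotents_def)
  moreover have "idempotent_pure S \<rho> \<longleftrightarrow> kern S \<rho> = idempotents S"
    using congruence_refl[OF assms] idemD(1) unfolding idempotent_pure_def kern_def by blast
  moreover have "Id_on (carrier S) \<subseteq> lower_k S \<rho>"
    using lower_k_least(1)[OF assms] congruence_refl by blast
  ultimately show ?thesis
    using lower_k_least[OF assms] congruence_Id_on by (metis subset_antisym)
qed

text \<open>\<open>\<tau>\<close> is the syntactic congruence of the set of idempotents.\<close>

inductive_set shifts :: "('a \<Rightarrow> 'a) set" where
  id: "(\<lambda>x. x) \<in> shifts"
| left: "t \<in> shifts \<Longrightarrow> c \<in> carrier S \<Longrightarrow> (\<lambda>x. t (c \<cdot> x)) \<in> shifts"
| right: "t \<in> shifts \<Longrightarrow> c \<in> carrier S \<Longrightarrow> (\<lambda>x. t (x \<cdot> c)) \<in> shifts"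

lemma congruence_shift:
  assumes "congruence S \<rho>" "t \<in> shifts" "(a, b) \<in> \<rho>"
  shows "(t a, t b) \<in> \<rho>"
  using assms(2,3)
  by (induction arbitrary: a b)
    (auto intro: congruence_mult[OF assms(1)] congruence_refl[OF assms(1)])

text \<open>The trivial shift makes \<open>T\<close> idempotent pure. An idempotent pure congruence
  never relates an idempotent to a non-idempotent, and it is preserved by shifts, so it lies in
  \<open>T\<close>.\<close>

lemma tau_congruence: "congruence S (tau S)"
  and tau_idempotent_pure: "idempotent_pure S (tau S)"
  and tau_greatest: "congruence S \<rho> \<Longrightarrow> idempotent_pure S \<rho> \<Longrightarrow> \<rho> \<subseteq> tau S"
proof -
  define T where "T = {(a, b) \<in> carrier S \<times> carrier S.
    \<forall>t\<in>shifts. t a \<in> idempotents S \<longleftrightarrow> t b \<in> idempotents S}"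
  have T: "congruence S T"
  proof (rule congruenceI)
    show "(c \<cdot> a, c \<cdot> b) \<in> T" "(a \<cdot> c, b \<cdot> c) \<in> T" if "(a, b) \<in> T" "c \<in> carrier S" for a b c
      using that shifts.left shifts.right by (fastforce simp: T_def closed)+
  qed (auto simp: T_def)
  have "idempotent_pure S T"
    unfolding idempotent_pure_def T_def using shifts.id by auto
  moreover have sub: "\<rho> \<subseteq> T" if \<rho>: "congruence S \<rho>" "idempotent_pure S \<rho>" for \<rho>
  proof -
    have "t b \<in> idempotents S" if "(a, b) \<in> \<rho>" "t \<in> shifts" "t a \<in> idempotents S" for a b t
      using congruence_shift[OF \<rho>(1) that(2) congruence_sym[OF \<rho>(1) that(1)]] that(3)
        \<rho>(2) congruence_subset[OF \<rho>(1)] unfolding idempotent_pure_def by blast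
    then show ?thesis
      using congruence_subset[OF \<rho>(1)] congruence_sym[OF \<rho>(1)] unfolding T_def by blast
  qed
  ultimately have "tau S = T"
    unfolding tau_def using T by (intro Greatest_equality) auto
  then show "congruence S (tau S)" "idempotent_pure S (tau S)"
    "congruence S \<rho> \<Longrightarrow> idempotent_pure S \<rho> \<Longrightarrow> \<rho> \<subseteq> tau S"
    using T \<open>idempotent_pure S T\<close> sub by auto
qed

lemma idempotent_pure_mono:
  "idempotent_pure S \<sigma> \<Longrightarrow> \<rho> \<subseteq> \<sigma> \<Longrightarrow> idempotent_pure S \<rho>"
  unfolding idempotent_pure_def by blast

lemma idempotent_pure_kappa_iff_subset_tau: "idempotent_pure S (kappa S) \<longleftrightarrow> kappa S \<subseteq> tau S"
  using idempotent_pure_mono tau_idempotent_pure tau_greatest kappa_congruence by blast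

lemma idempotent_pure_kappa_iff_cryptogroup_congruence:
  "idempotent_pure S (kappa S) \<longleftrightarrow>
     (\<exists>\<rho>. cryptogroup_congruence S \<rho> \<and> idempotent_pure S \<rho>)"
  using kappa_cryptogroup_congruence kappa_least idempotent_pure_mono by blast


subsection \<open>Rectangular groups\<close>

lemma zero_inv:
  assumes "a \<in> carrier S"
  shows "(a\<^sup>-)\<degree> = a\<degree>"
  using assms
  by (intro zero_eqI[of _ a]) (simp_all add: inv_closed inv_mult mult_inv zero_mult zero_mult_inv)

text \<open>The factors are the band of idempotents of \<open>A\<close> and the group of those
  \<open>a\<close> in \<open>A\<close> with \<open>a\<degree> = e\<close>. The isomorphism sends
  \<open>a\<close> to \<open>(a\<degree>, e \<cdot> a \<cdot> e)\<close>, and its inverse sends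
  \<open>(f, g)\<close> to \<open>f \<cdot> g \<cdot> f\<close>.\<close>

lemma rectangular_groupI:
  assumes A: "A \<subseteq> carrier S" "\<And>a b. a \<in> A \<Longrightarrow> b \<in> A \<Longrightarrow> a \<cdot> b \<in> A" "\<And>a. a \<in> A \<Longrightarrow> a\<^sup>- \<in> A"
    and mid: "\<And>e f g. e \<in> A \<inter> idempotents S \<Longrightarrow> f \<in> A \<inter> idempotents S \<Longrightarrow>
      g \<in> A \<inter> idempotents S \<Longrightarrow> e \<cdot> f \<cdot> g = e \<cdot> g"
    and e: "e \<in> A \<inter> idempotents S"
  shows "rectangular_group (subsemigrp S A)"
proof -
  let ?E = "A \<inter> idempotents S" and ?G = "{a \<in> A. a\<degree> = e}"
  have C: "a \<in> carrier S" if "a \<in> A" for a using A(1) that by blast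
  have z: "a\<degree> \<in> ?E" if "a \<in> A" for a
    using A(2)[OF that A(3)[OF that]] mult_inv[OF C[OF that]] zero_idempotent[OF C[OF that]] by simp
  \<comment> \<open>Splitting off \<open>a\<degree>\<close> and \<open>b\<degree>\<close> extends
    the law \<open>mid\<close> from idempotent outer factors to arbitrary ones.\<close>
  have drop: "a \<cdot> f \<cdot> b = a \<cdot> b" if "a \<in> A" "f \<in> ?E" "b \<in> A" for a b f
  proof -
    have f: "f \<in> carrier S" using that C by blast
    have "a \<cdot> f \<cdot> b = (a \<cdot> a\<degree>) \<cdot> f \<cdot> (b\<degree> \<cdot> b)"
      using that(1,3) C by (simp add: mult_zero zero_mult)
    also have "\<dots> = a \<cdot> (a\<degree> \<cdot> f \<cdot> b\<degree>) \<cdot> b"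
      using that(1,3) C f by (simp add: assoc closed zero_closed)
    also have "\<dots> = a \<cdot> (a\<degree> \<cdot> b\<degree>) \<cdot> b"
      using mid[OF z[OF that(1)] that(2) z[OF that(3)]] by simp
    also have "\<dots> = (a \<cdot> a\<degree>) \<cdot> (b\<degree> \<cdot> b)"
      using that(1,3) C by (simp add: assoc closed zero_closed)
    finally show ?thesis using that C by (simp add: mult_zero zero_mult)
  qed
  \<comment> \<open>\<open>(a \<cdot> b)\<degree>\<close> absorbs \<open>a\<degree>\<close> on the
    left and \<open>b\<degree>\<close> on the right, and \<open>mid\<close> deletes it between
    them.\<close>
  have zm: "(a \<cdot> b)\<degree> = a\<degree> \<cdot> b\<degree>" if "a \<in> A" "b \<in> A" for a b
    using mid[OF z z z, OF that(1) A(2)[OF that] that(2)]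
      zero_mult_left[OF C C, OF that] zero_mult_right[OF C C, OF that] by simp
  have id: "f\<degree> = f" "f \<cdot> f = f" if "f \<in> ?E" for f
    using that zero_of_idempotent idemD(2) by auto
  have EE: "a \<cdot> b \<in> ?E" if "a \<in> ?E" "b \<in> ?E" for a b
    using that z[of "a \<cdot> b"] A(2)[of a b] zm id(1)[OF that(1)] id(1)[OF that(2)] by simp

  define B where "B = subsemigrp S ?E"
  define G where "G = \<lparr>carrier = ?G, mult = sgmult S, one = e\<rparr>"
  have B: "carrier B = ?E" "sgmult B = sgmult S" by (simp_all add: B_def subsemigrp_def)
  have G: "carrier G = ?G" "mult G = sgmult S" "one G = e" by (simp_all add: G_def)
  have T: "carrier (subsemigrp S A) = A" "sgmult (subsemigrp S A) = sgmult S"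
    by (simp_all add: subsemigrp_def)
  have P: "carrier (direct_product B G) = ?E \<times> ?G"
    "(a, g) \<cdot>\<^bsub>direct_product B G\<^esub> (b, h) = (a \<cdot> b, g \<cdot> h)" for a b g h
    by (simp_all add: direct_product_def B G)

  have "rectangular_band B"
    unfolding rectangular_band_def semigrp_def B
  proof (intro conjI allI impI ballI)
    show "a = a \<cdot> x \<cdot> a" if "a \<in> ?E" "x \<in> ?E" for a x
      using mid[OF that that(1)] id(2)[OF that(1)] by simp
  qed (use EE assoc C in blast)+
  moreover have "group G"
  proof (rule groupI, unfold G)
    show "\<exists>y\<in>?G. y \<cdot> x = e" if "x \<in> ?G" for x
      using that A(3) C by (intro bexI[of _ "x\<^sup>-"]) (auto simp: zero_inv inv_mult)
    show "e \<cdot> x = x" if "x \<in> ?G" for x using that C zero_mult by blast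
    show "x \<cdot> y \<in> ?G" if "x \<in> ?G" "y \<in> ?G" for x y
      using that A(2)[of x y] zm[of x y] id(2)[OF e] by simp
  qed (use C e id(1) assoc in blast)+
  moreover have "semigrp (subsemigrp S A)"
    unfolding semigrp_def T by (intro conjI allI impI A(2) assoc C)
  moreover have "semigrp_iso (subsemigrp S A) (direct_product B G)"
    unfolding semigrp_iso_def T P(1)
  proof (intro exI[of _ "\<lambda>a. (a\<degree>, e \<cdot> a \<cdot> e)"] conjI ballI)
    have eA: "e \<in> A" using e by blast
    show "bij_betw (\<lambda>a. (a\<degree>, e \<cdot> a \<cdot> e)) A (?E \<times> ?G)"
    proof (rule bij_betw_byWitness[where f' = "\<lambda>(f, g). f \<cdot> g \<cdot> f"])
      show "\<forall>a\<in>A. (case (a\<degree>, e \<cdot> a \<cdot> e) of (f, g) \<Rightarrow> f \<cdot> g \<cdot> f) = a"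
      proof
        fix a assume a: "a \<in> A"
        have "a\<degree> \<cdot> (e \<cdot> a \<cdot> e) \<cdot> a\<degree> = (a\<degree> \<cdot> e \<cdot> a) \<cdot> e \<cdot> a\<degree>"
          using a C eA by (simp add: assoc closed zero_closed)
        also have "\<dots> = a"
          using drop[OF IntD1[OF z[OF a]] e a] drop[OF a e IntD1[OF z[OF a]]]
            zero_mult[OF C[OF a]] mult_zero[OF C[OF a]] by simp
        finally show "(case (a\<degree>, e \<cdot> a \<cdot> e) of (f, g) \<Rightarrow> f \<cdot> g \<cdot> f) = a" by simp
      qed
      show "\<forall>p\<in>?E \<times> ?G. ((case p of (f, g) \<Rightarrow> f \<cdot> g \<cdot> f)\<degree>,
          e \<cdot> (case p of (f, g) \<Rightarrow> f \<cdot> g \<cdot> f) \<cdot> e) = p"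
      proof
        fix p assume "p \<in> ?E \<times> ?G"
        then obtain f g where p: "p = (f, g)" and f: "f \<in> ?E" and g: "g \<in> A" "g\<degree> = e" by auto
        have fA: "f \<in> A" using f by blast
        have "(f \<cdot> g \<cdot> f)\<degree> = f \<cdot> e \<cdot> f"
          using zm[OF A(2)[OF fA g(1)] fA] zm[OF fA g(1)] id[OF f] g by simp
        then have 1: "(f \<cdot> g \<cdot> f)\<degree> = f" using mid[OF f e f] id[OF f] by simp
        have "e \<cdot> (f \<cdot> g \<cdot> f) \<cdot> e = (e \<cdot> f \<cdot> g) \<cdot> f \<cdot> e"
          using C fA g eA by (simp add: assoc closed)
        also have "\<dots> = g"
          using drop[OF eA f g(1)] drop[OF g(1) f eA] zero_mult[OF C[OF g(1)]]
            mult_zero[OF C[OF g(1)]] g(2) by simp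
        finally show "((case p of (f, g) \<Rightarrow> f \<cdot> g \<cdot> f)\<degree>,
            e \<cdot> (case p of (f, g) \<Rightarrow> f \<cdot> g \<cdot> f) \<cdot> e) = p"
          using 1 p by simp
      qed
      show "(\<lambda>a. (a\<degree>, e \<cdot> a \<cdot> e)) ` A \<subseteq> ?E \<times> ?G"
      proof clarify
        fix a assume a: "a \<in> A"
        have "(e \<cdot> a \<cdot> e)\<degree> = e"
          using zm[OF A(2)[OF eA a] eA] zm[OF eA a] mid[OF e z[OF a] e] id[OF e] by simp
        then show "a\<degree> \<in> ?E \<and> e \<cdot> a \<cdot> e \<in> ?G"
          using z[OF a] A(2)[OF A(2)[OF eA a] eA] by blast
      qed
      show "(\<lambda>(f, g). f \<cdot> g \<cdot> f) ` (?E \<times> ?G) \<subseteq> A" using A(2) by auto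
    qed
    fix a b assume ab: "a \<in> A" "b \<in> A"
    have "e \<cdot> a \<cdot> e \<cdot> (e \<cdot> b \<cdot> e) = e \<cdot> (a \<cdot> (e \<cdot> e) \<cdot> b) \<cdot> e"
      using ab C eA by (simp add: assoc closed)
    also have "\<dots> = e \<cdot> (a \<cdot> b) \<cdot> e" using drop[OF ab(1) e ab(2)] id[OF e] by simp
    finally show "((a \<cdot> b)\<degree>, e \<cdot> (a \<cdot> b) \<cdot> e) =
        (a\<degree>, e \<cdot> a \<cdot> e) \<cdot>\<^bsub>direct_product B G\<^esub> (b\<degree>, e \<cdot> b \<cdot> e)"
      using zm[OF ab] P(2) by simp
  qed
  ultimately show ?thesis unfolding rectangular_group_def by blast
qed


subsection \<open>Principal ideals\<close>

text \<open>The preorder behind Green's relation J. The factors are taken in \<open>S\<close>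
  itself; reflexivity comes from \<open>a = a\<degree> \<cdot> a \<cdot> a\<degree>\<close>.\<close>

definition ideal_le :: "'a \<Rightarrow> 'a \<Rightarrow> bool" where
  "ideal_le a b \<longleftrightarrow> (\<exists>x\<in>carrier S. \<exists>y\<in>carrier S. a = x \<cdot> b \<cdot> y)"

lemma ideal_leI: "x \<in> carrier S \<Longrightarrow> y \<in> carrier S \<Longrightarrow> a = x \<cdot> b \<cdot> y \<Longrightarrow> ideal_le a b"
  unfolding ideal_le_def by blast

lemma ideal_le_refl: "a \<in> carrier S \<Longrightarrow> ideal_le a a"
  by (rule ideal_leI[of "a\<degree>" "a\<degree>"]) (simp_all add: zero_closed zero_mult mult_zero)

lemma ideal_le_trans:
  assumes "ideal_le a b" "ideal_le b c" "c \<in> carrier S"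
  shows "ideal_le a c"
proof -
  obtain x y where xy: "x \<in> carrier S" "y \<in> carrier S" "a = x \<cdot> b \<cdot> y"
    using assms(1) unfolding ideal_le_def by blast
  obtain u v where uv: "u \<in> carrier S" "v \<in> carrier S" "b = u \<cdot> c \<cdot> v"
    using assms(2) unfolding ideal_le_def by blast
  have "a = (x \<cdot> u) \<cdot> c \<cdot> (v \<cdot> y)"
    using xy uv assms(3) by (simp add: assoc closed)
  then show ?thesis using xy uv ideal_leI closed by metis
qed

lemma ideal_le_mult_left:
  assumes "a \<in> carrier S" "b \<in> carrier S"
  shows "ideal_le (a \<cdot> b) a"
  using assms by (intro ideal_leI[of "a\<degree>" b]) (simp_all add: zero_closed zero_mult)

lemma ideal_le_mult_right:
  assumes "a \<in> carrier S" "b \<in> carrier S"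
  shows "ideal_le (a \<cdot> b) b"
  using assms by (intro ideal_leI[of a "b\<degree>"]) (simp_all add: zero_closed mult_zero assoc)

lemma ideal_le_square: "a \<in> carrier S \<Longrightarrow> ideal_le a (a \<cdot> a)"
  using assoc[of "a\<^sup>-" a a]
  by (intro ideal_leI[of "a\<^sup>-" "a\<degree>"])
    (simp_all add: inv_closed zero_closed inv_mult zero_mult mult_zero)

text \<open>If \<open>c = x a y = u b v\<close> then \<open>c c = u (b (v x a)) y\<close>, and the square of \<open>b (v x a)\<close> lies in the
  ideal generated by \<open>a b\<close>.\<close>

lemma ideal_le_mult:
  assumes C: "a \<in> carrier S" "b \<in> carrier S" "c \<in> carrier S"
    and "ideal_le c a" "ideal_le c b"
  shows "ideal_le c (a \<cdot> b)"
proof -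
  obtain x y where xy: "x \<in> carrier S" "y \<in> carrier S" "c = x \<cdot> a \<cdot> y"
    using assms(4) unfolding ideal_le_def by blast
  obtain u v where uv: "u \<in> carrier S" "v \<in> carrier S" "c = u \<cdot> b \<cdot> v"
    using assms(5) unfolding ideal_le_def by blast
  define d where "d = b \<cdot> (v \<cdot> x \<cdot> a)"
  have d: "d \<in> carrier S" using xy uv C by (simp add: d_def closed)
  have "c \<cdot> c = (u \<cdot> b \<cdot> v) \<cdot> (x \<cdot> a \<cdot> y)" using xy(3) uv(3) by simp
  also have "\<dots> = u \<cdot> d \<cdot> y" unfolding d_def using xy(1,2) uv(1,2) C by (simp add: assoc closed)
  finally have cd: "ideal_le (c \<cdot> c) d" using xy uv ideal_leI by blast
  have "d \<cdot> d = (b \<cdot> v \<cdot> x) \<cdot> (a \<cdot> b) \<cdot> (v \<cdot> x \<cdot> a)"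
    unfolding d_def using xy(1,2) uv(1,2) C by (simp add: assoc closed)
  then have "ideal_le (d \<cdot> d) (a \<cdot> b)" using xy uv C ideal_leI closed by metis
  then show ?thesis
    using ideal_le_trans ideal_le_square cd C d closed by metis
qed

definition green_J :: "'a rel" where
  "green_J = {(a, b) \<in> carrier S \<times> carrier S. ideal_le a b \<and> ideal_le b a}"

text \<open>In the order of principal ideals \<open>a \<cdot> b\<close> is a greatest lower bound of
  \<open>a\<close> and \<open>b\<close>, so multiplication is monotone; \<open>a\<close> and
  \<open>a \<cdot> a\<close> generate the same ideal.\<close>

lemma band_congruence_green_J: "band_congruence S green_J"
proof -
  have le: "ideal_le (a \<cdot> c) (b \<cdot> d)"
    if "a \<in> carrier S" "b \<in> carrier S" "c \<in> carrier S" "d \<in> carrier S"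
      and "ideal_le a b" "ideal_le c d" for a b c d
    using that ideal_le_mult[of b d "a \<cdot> c"] ideal_le_trans[of "a \<cdot> c"]
      ideal_le_mult_left ideal_le_mult_right closed by metis
  have "congruence S green_J"
  proof (rule congruenceI)
    show "(a, c) \<in> green_J" if "(a, b) \<in> green_J" "(b, c) \<in> green_J" for a b c
      using that ideal_le_trans[of a b c] ideal_le_trans[of c b a] by (simp add: green_J_def)
  qed (auto simp: green_J_def ideal_le_refl closed le)
  then show ?thesis
    by (auto simp: band_congruence_iff green_J_def closed ideal_le_square ideal_le_mult_left)
qed

lemma kappa_subset_green_J: "kappa S \<subseteq> green_J"
  using kappa_subset_beta beta_least[OF band_congruence_green_J] by blast

text \<open>For \<open>e = x \<cdot> f \<cdot> y\<close> put
  \<open>p = e \<cdot> x \<cdot> f\<close>. Then \<open>p \<cdot> (y \<cdot> e) = e\<close> makes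
  \<open>p\<degree>\<close> a left identity of \<open>e\<close>, while
  \<open>p \<cdot> f = p\<close> gives \<open>p\<degree> \<cdot> f = p\<degree>\<close>. Together
  these yield \<open>e = p\<degree>\<close> and hence \<open>e = e \<cdot> f = f\<close>.\<close>

lemma idempotent_primitive:
  assumes ef: "e \<in> idempotents S" "f \<in> idempotents S" "e \<cdot> f = f" "f \<cdot> e = f" and "ideal_le e f"
  shows "e = f"
proof -
  note E = idemD(1)[OF ef(1)] idemD(1)[OF ef(2)] idemD(2)[OF ef(1)] idemD(2)[OF ef(2)]
  obtain x y where xy: "x \<in> carrier S" "y \<in> carrier S" "e = x \<cdot> f \<cdot> y"
    using assms(5) unfolding ideal_le_def by blast
  define p where "p = e \<cdot> x \<cdot> f"
  have p: "p \<in> carrier S" using xy E by (simp add: p_def closed)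
  have pf: "p \<cdot> f = p"
    unfolding p_def using xy(1) E by (simp add: assoc closed)
  have "p \<cdot> (y \<cdot> e) = e \<cdot> (x \<cdot> f \<cdot> y) \<cdot> e"
    unfolding p_def using xy(1,2) E by (simp add: assoc closed)
  then have pq: "p \<cdot> (y \<cdot> e) = e" using xy(3) E by simp
  have "p\<degree> \<cdot> e = p\<degree> \<cdot> p \<cdot> (y \<cdot> e)"
    using pq assoc[of "p\<degree>" p "y \<cdot> e"] xy p E by (simp add: zero_closed closed)
  then have pe: "p\<degree> \<cdot> e = e" using pq p by (simp add: zero_mult)
  have p0: "p\<degree> \<cdot> f = p\<degree>" using zero_right_absorb[OF p _ pf] E by simp
  have "e = p\<degree> \<cdot> f \<cdot> e" using pe p0 by simp
  also have "\<dots> = p\<degree> \<cdot> (f \<cdot> e)" using p E(1,2) by (simp add: assoc zero_closed)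
  also have "\<dots> = p\<degree>" using ef(4) p0 by simp
  finally have "e = p\<degree>" .
  then show ?thesis using p0 ef(3) by simp
qed


subsection \<open>Idempotent pure \<open>\<kappa>\<close>\<close>

text \<open>The form in which most of the conditions are led back to purity.\<close>

lemma idempotent_pure_if_zero_eq:
  assumes "\<And>a. a \<in> carrier S \<Longrightarrow> (a, a\<degree>) \<in> kappa S \<Longrightarrow> a = a\<degree>"
  shows "idempotent_pure S (kappa S)"
  unfolding idempotent_pure_iff[OF kappa_congruence] using assms zero_idempotent by metis

section \<open>Consequences of idempotent purity\<close>

context
  assumes pure: "idempotent_pure S (kappa S)"
begin

lemma kappa_idempotent:
  "(a, e) \<in> kappa S \<Longrightarrow> e \<in> idempotents S \<Longrightarrow> a \<in> idempotents S"
  using pure congruence_subset[OF kappa_congruence] unfolding idempotent_pure_def by blast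

text \<open>Purity makes \<open>f\<close> idempotent, and \<open>kappa S\<close> lies in
  \<open>green_J\<close>, so primitivity applies.\<close>

lemma kappa_below:
  assumes "e \<in> idempotents S" "(f, e) \<in> kappa S" "e \<cdot> f = f" "f \<cdot> e = f"
  shows "f = e"
  using idempotent_primitive[of e f] assms kappa_idempotent kappa_subset_green_J
  by (auto simp: green_J_def)

text \<open>The element \<open>e \<cdot> x \<cdot> e\<close> stays in the class of \<open>e\<close>
  and lies below \<open>e\<close>.\<close>

lemma kappa_sandwich:
  assumes e: "e \<in> idempotents S" and x: "(x, e) \<in> kappa S"
  shows "e \<cdot> x \<cdot> e = e"
proof (rule kappa_below[OF e])
  note \<kappa> = kappa_congruence
  have C: "e \<in> carrier S" "x \<in> carrier S" "e \<cdot> e = e"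
    using e idemD x congruence_subset[OF \<kappa>] by auto
  have ee: "(e, e) \<in> kappa S" using congruence_refl[OF \<kappa>] C by blast
  show "(e \<cdot> x \<cdot> e, e) \<in> kappa S"
    using congruence_mult[OF \<kappa> congruence_mult[OF \<kappa> ee x] ee] C by simp
  show "e \<cdot> x \<cdot> e \<cdot> e = e \<cdot> x \<cdot> e" using C by (simp add: assoc closed)
  show "e \<cdot> (e \<cdot> x \<cdot> e) = e \<cdot> x \<cdot> e" using C by (simp add: closed flip: assoc)
qed

text \<open>Purity makes \<open>g\<close> idempotent, so \<open>g \<cdot> e \<cdot> g = g\<close>.
  Expanding the first \<open>e\<close> of \<open>e \<cdot> g\<close> to
  \<open>e \<cdot> (x \<cdot> g) \<cdot> e\<close> leaves
  \<open>e \<cdot> x \<cdot> g\<close>.\<close>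

lemma kappa_middle:
  assumes e: "e \<in> idempotents S" and x: "(x, e) \<in> kappa S" and g: "(g, e) \<in> kappa S"
  shows "e \<cdot> x \<cdot> g = e \<cdot> g"
proof -
  note \<kappa> = kappa_congruence
  have C: "e \<in> carrier S" "x \<in> carrier S" "g \<in> carrier S"
    using e idemD x g congruence_subset[OF \<kappa>] by auto
  have ge: "g \<cdot> e \<cdot> g = g"
    using kappa_sandwich[of g e] congruence_sym[OF \<kappa> g] kappa_idempotent[OF g e] by blast
  have "(x \<cdot> g, e) \<in> kappa S"
    using congruence_mult[OF \<kappa> x g] idemD(2)[OF e] by simp
  then have "e \<cdot> g = e \<cdot> (x \<cdot> g) \<cdot> e \<cdot> g" using kappa_sandwich[OF e] by simp
  also have "\<dots> = e \<cdot> x \<cdot> (g \<cdot> e \<cdot> g)" using C by (simp add: assoc closed)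
  finally show ?thesis using ge by simp
qed

lemma over_rectangular_bands_kappa: "over_rectangular_bands S (kappa S)"
  unfolding over_rectangular_bands_def
proof
  note \<kappa> = kappa_congruence
  fix e assume e: "e \<in> idempotents S"
  let ?K = "subsemigrp S (kappa S `` {e})"
  have K: "carrier ?K = kappa S `` {e}" "sgmult ?K = sgmult S" by (simp_all add: subsemigrp_def)
  have sub: "kappa S `` {e} \<subseteq> carrier S" using congruence_subset[OF \<kappa>] by blast
  have "semigrp ?K"
  proof (unfold_locales, unfold K)
    show "a \<cdot> b \<in> kappa S `` {e}" if "a \<in> kappa S `` {e}" "b \<in> kappa S `` {e}" for a b
      using that congruence_mult[OF \<kappa>, of e a e b] idemD(2)[OF e] by simp
  qed (use sub assoc in blast)
  moreover have "a = a \<cdot> x \<cdot> a" if "(e, a) \<in> kappa S" "(e, x) \<in> kappa S" for a x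
  proof -
    have "(a, e) \<in> kappa S" "(x, a) \<in> kappa S"
      by (meson that congruence_sym[OF \<kappa>] congruence_trans[OF \<kappa>])+
    then show ?thesis using kappa_sandwich[of a x] kappa_idempotent e by simp
  qed
  ultimately show "rectangular_band ?K" by (simp add: rectangular_band_def K)
qed

text \<open>For a pair in the intersection, \<open>a \<cdot> b\<^sup>-\<close> is related to
  \<open>b\<degree>\<close> and has it as a two-sided identity, hence equals it; multiplying by
  \<open>b\<close> gives \<open>a = b\<close>.\<close>

lemma kappa_Int_green_H: "kappa S \<inter> green_H S = Id_on (carrier S)"
proof -
  note \<kappa> = kappa_congruence
  have "a = b" if ab: "(a, b) \<in> kappa S" "(a, b) \<in> green_H S" for a b
  proof -
    have C: "a \<in> carrier S" "b \<in> carrier S" and z: "a\<degree> = b\<degree>"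
      using ab by (auto simp: green_H_eq)
    have bb: "(b\<^sup>-, b\<^sup>-) \<in> kappa S" using congruence_refl[OF \<kappa>] inv_closed C by blast
    have "a \<cdot> b\<^sup>- = b\<degree>"
    proof (rule kappa_below)
      show "(a \<cdot> b\<^sup>-, b\<degree>) \<in> kappa S"
        using congruence_mult[OF \<kappa> ab(1) bb] C by (simp add: mult_inv)
      show "b\<degree> \<cdot> (a \<cdot> b\<^sup>-) = a \<cdot> b\<^sup>-"
        using C by (simp add: zero_closed inv_closed zero_mult flip: assoc z)
      show "a \<cdot> b\<^sup>- \<cdot> b\<degree> = a \<cdot> b\<^sup>-"
        using C by (simp add: zero_closed inv_closed assoc inv_mult_zero)
    qed (use C zero_idempotent in blast)
    then have "a \<cdot> b\<^sup>- \<cdot> b = b" using C by (simp add: zero_mult)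
    then have "a \<cdot> b\<degree> = b" using C by (simp add: assoc inv_closed inv_mult)
    then show ?thesis using C mult_zero[of a] z by simp
  qed
  moreover have "Id_on (carrier S) \<subseteq> kappa S \<inter> green_H S"
    using congruence_refl[OF \<kappa>] by (auto simp: green_H_eq)
  ultimately show ?thesis using congruence_subset[OF \<kappa>] by auto
qed

lemma kappa_subset_rel_F: "kappa S \<subseteq> rel_F S"
proof -
  note \<kappa> = kappa_congruence
  have "a \<cdot> b\<^sup>- \<in> idempotents S" if ab: "(a, b) \<in> kappa S" "b \<in> carrier S" for a b
  proof (rule kappa_idempotent)
    show "(a \<cdot> b\<^sup>-, b \<cdot> b\<^sup>-) \<in> kappa S"
      using congruence_mult[OF \<kappa> ab(1) congruence_refl[OF \<kappa>]] inv_closed ab(2) by blast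
  qed (use ab mult_inv zero_idempotent in simp)
  then show ?thesis using congruence_subset[OF \<kappa>] by (auto simp: rel_F_def)
qed

text \<open>Sandwiching \<open>x \<cdot> b\<close> between copies of the idempotent
  \<open>x \<cdot> a\<close> gives \<open>x = x \<cdot> b \<cdot> x\<close>. The other equation
  needs H.\<close>

lemma kappa_inverses_subset:
  assumes ab: "(a, b) \<in> kappa S"
  shows "inverses S a \<subseteq> inverses S b"
proof
  note \<kappa> = kappa_congruence
  have C: "a \<in> carrier S" "b \<in> carrier S" using ab congruence_subset[OF \<kappa>] by auto
  fix x assume "x \<in> inverses S a"
  then have x: "x \<in> carrier S" "a \<cdot> x \<cdot> a = a" "x \<cdot> a \<cdot> x = x"
    by (auto simp: inverses_def)
  have ba: "(b, a) \<in> kappa S" and xx: "(x, x) \<in> kappa S"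
    using congruence_sym[OF \<kappa> ab] congruence_refl[OF \<kappa> x(1)] .
  have "(x \<cdot> a) \<cdot> (x \<cdot> a) = (x \<cdot> a \<cdot> x) \<cdot> a"
    using C x(1) by (simp add: assoc closed)
  then have xa: "x \<cdot> a \<in> idempotents S" using x C by (simp add: idempotents_def closed)
  have "(x \<cdot> a) \<cdot> (x \<cdot> b) \<cdot> (x \<cdot> a) = x \<cdot> a"
    using kappa_sandwich[OF xa congruence_mult[OF \<kappa> xx ba]] .
  then have "x \<cdot> a \<cdot> x = (x \<cdot> a) \<cdot> (x \<cdot> b) \<cdot> (x \<cdot> a) \<cdot> x" by simp
  also have "\<dots> = (x \<cdot> a \<cdot> x) \<cdot> b \<cdot> (x \<cdot> a \<cdot> x)" using C x(1) by (simp add: assoc closed)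
  finally have xbx: "x = x \<cdot> b \<cdot> x" using x by simp
  \<comment> \<open>\<open>c\<close> is related to \<open>a \<cdot> x \<cdot> a = a\<close> and so
    to \<open>b\<close>. Since \<open>b\<degree>\<close> is a two-sided identity for
    \<open>c\<close>, \<open>kappa_below\<close> gives \<open>c\<degree> = b\<degree>\<close>; then
    \<open>c\<close> and \<open>b\<close> are also H-related and coincide.\<close>
  define c where "c = b \<cdot> x \<cdot> b"
  have c: "c \<in> carrier S" using C x by (simp add: c_def closed)
  have "(c, a \<cdot> x \<cdot> a) \<in> kappa S"
    unfolding c_def by (intro congruence_mult[OF \<kappa>] ba xx)
  then have cb: "(c, b) \<in> kappa S" unfolding x(2) using congruence_trans[OF \<kappa> _ ab] by blast
  have "b\<degree> \<cdot> c = c" "c \<cdot> b\<degree> = c"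
    unfolding c_def using C x(1)
    by (simp_all add: zero_closed closed mult_zero assoc)
      (simp add: zero_closed closed zero_mult flip: assoc)
  then have "b\<degree> = c\<degree>"
    using zero_left_absorb[of c "b\<degree>"] zero_right_absorb[of c "b\<degree>"]
      kappa_below[of "b\<degree>" "c\<degree>"] congruence_zero[OF \<kappa> cb] C c zero_closed zero_idempotent
    by simp
  then have "(c, b) \<in> kappa S \<inter> green_H S" using cb C c by (simp add: green_H_eq)
  then have "c = b" unfolding kappa_Int_green_H by (simp add: Id_on_iff)
  then show "x \<in> inverses S b"
    using x xbx by (simp add: inverses_def c_def)
qed

lemma kappa_subset_rel_Y: "kappa S \<subseteq> rel_Y S"
  using kappa_inverses_subset congruence_sym[OF kappa_congruence] congruence_subset[OF kappa_congruence]
  unfolding rel_Y_def by blast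

lemma beta_idempotent_kappa:
  assumes "e \<in> idempotents S" "f \<in> idempotents S" "(e, f) \<in> beta S"
  shows "(e, f) \<in> kappa S"
  using assms by (simp add: beta_eq zero_of_idempotent)

text \<open>The idempotents \<open>a \<cdot> b\<^sup>-\<close>, \<open>a\<degree>\<close> and
  \<open>b\<degree>\<close> are related by \<open>beta S\<close>, hence by \<open>kappa S\<close>.
  So \<open>kappa_middle\<close> gives
  \<open>a \<cdot> b\<^sup>- = a\<degree> \<cdot> b\<degree>\<close>, and multiplying by
  \<open>b\<close> gives \<Theta>.\<close>

lemma beta_Int_rel_F_subset: "beta S \<inter> rel_F S \<subseteq> rel_Theta S"
proof
  fix p assume "p \<in> beta S \<inter> rel_F S"
  then obtain a b where p: "p = (a, b)" and ab: "(a, b) \<in> beta S" and E: "a \<cdot> b\<^sup>- \<in> idempotents S"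
    and C: "a \<in> carrier S" "b \<in> carrier S"
    by (auto simp: rel_F_def)
  note \<beta> = beta_congruence
  have z: "(a\<degree>, b\<degree>) \<in> beta S" using congruence_zero[OF \<beta> ab] .
  have "(a \<cdot> b\<^sup>-, b \<cdot> b\<^sup>-) \<in> beta S"
    using congruence_mult[OF \<beta> ab congruence_refl[OF \<beta> inv_closed]] C by blast
  then have "(a \<cdot> b\<^sup>-, a\<degree>) \<in> beta S"
    using congruence_trans[OF \<beta> _ congruence_sym[OF \<beta> z]] C by (simp add: mult_inv)
  then have f: "(a \<cdot> b\<^sup>-, a\<degree>) \<in> kappa S" and z: "(b\<degree>, a\<degree>) \<in> kappa S"
    using E z congruence_sym[OF \<beta>] C zero_idempotent by (blast intro: beta_idempotent_kappa)+
  have "a \<cdot> b\<^sup>- = a\<degree> \<cdot> (a \<cdot> b\<^sup>-) \<cdot> b\<degree>"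
    using C by (simp add: zero_closed inv_closed closed inv_mult_zero assoc)
      (simp add: zero_closed inv_closed zero_mult flip: assoc)
  also have "\<dots> = a\<degree> \<cdot> b\<degree>" using kappa_middle[OF _ f z] zero_idempotent C by blast
  finally have "a \<cdot> b\<^sup>- \<cdot> b = a\<degree> \<cdot> b\<degree> \<cdot> b" by simp
  then have "a \<cdot> b\<degree> = a\<degree> \<cdot> b" using C by (simp add: assoc inv_closed zero_closed inv_mult zero_mult)
  then show "p \<in> rel_Theta S" using p C by (simp add: rel_Theta_def)
qed

text \<open>Modulo \<open>kappa S\<close>, \<open>a = a \<cdot> a\<degree>\<close> is related to
  \<open>a \<cdot> b\<degree> = a\<degree> \<cdot> b\<close>, and this to
  \<open>b\<degree> \<cdot> b = b\<close>.\<close>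

lemma beta_Int_rel_Theta_subset: "beta S \<inter> rel_Theta S \<subseteq> kappa S"
proof
  note \<kappa> = kappa_congruence
  fix p assume "p \<in> beta S \<inter> rel_Theta S"
  then obtain a b where p: "p = (a, b)" and ab: "(a\<degree>, b\<degree>) \<in> kappa S" and t: "a\<degree> \<cdot> b = a \<cdot> b\<degree>"
    and C: "a \<in> carrier S" "b \<in> carrier S"
    by (auto simp: rel_Theta_def beta_eq)
  have "(a \<cdot> a\<degree>, a \<cdot> b\<degree>) \<in> kappa S" "(a\<degree> \<cdot> b, b\<degree> \<cdot> b) \<in> kappa S"
    using congruence_mult[OF \<kappa> congruence_refl[OF \<kappa> C(1)] ab]
      congruence_mult[OF \<kappa> ab congruence_refl[OF \<kappa> C(2)]] .
  then show "p \<in> kappa S"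
    using t C p congruence_trans[OF \<kappa>, of a "a \<cdot> b\<degree>" b] by (simp add: zero_mult mult_zero)
qed

text \<open>Idempotents in one class of \<open>beta S\<close> are related by \<open>kappa S\<close>,
  so \<open>kappa_middle\<close> supplies the law that \<open>rectangular_groupI\<close>
  demands.\<close>

lemma beta_class_rectangular_group:
  assumes "A \<in> carrier S // beta S"
  shows "rectangular_group (subsemigrp S A)"
proof -
  note \<beta> = beta_congruence
  obtain a where a: "a \<in> carrier S" and A: "A = beta S `` {a}"
    using assms by (auto simp: quotient_def)
  have a0: "(a, a\<degree>) \<in> beta S" and aa: "(a, a \<cdot> a) \<in> beta S"
    using band_congruence_zero[OF beta_band_congruence a] beta_band_congruence a
    by (auto simp: band_congruence_iff)
  show ?thesis
  proof (rule rectangular_groupI[of A "a\<degree>"])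
    show "A \<subseteq> carrier S" using congruence_subset[OF \<beta>] A by blast
    show "x \<cdot> y \<in> A" if "x \<in> A" "y \<in> A" for x y
      using that congruence_trans[OF \<beta> aa congruence_mult[OF \<beta>]] A by blast
    show "x\<^sup>- \<in> A" if "x \<in> A" for x
    proof -
      have x: "(a, x) \<in> beta S" "x \<in> carrier S" using that A congruence_subset[OF \<beta>] by auto
      have "(x\<^sup>-, x\<degree>) \<in> beta S" "(x, x\<degree>) \<in> beta S"
        using band_congruence_zero[OF beta_band_congruence] x(2) inv_closed zero_inv by metis+
      then have "(a, x\<^sup>-) \<in> beta S"
        by (meson x(1) congruence_trans[OF \<beta>] congruence_sym[OF \<beta>])
      then show ?thesis using A by simp
    qed
    show "e \<cdot> f \<cdot> g = e \<cdot> g"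
      if "e \<in> A \<inter> idempotents S" "f \<in> A \<inter> idempotents S" "g \<in> A \<inter> idempotents S" for e f g
    proof (rule kappa_middle)
      have "(f, e) \<in> beta S" "(g, e) \<in> beta S"
        using that A by (meson IntD1 Image_singleton_iff congruence_trans[OF \<beta>] congruence_sym[OF \<beta>])+
      then show "(f, e) \<in> kappa S" "(g, e) \<in> kappa S"
        using that by (blast intro: beta_idempotent_kappa)+
    qed (use that in blast)
    show "a\<degree> \<in> A \<inter> idempotents S" using a0 a A zero_idempotent by blast
  qed
qed

end

text \<open>\<open>a \<cdot> b\<^sup>-\<close> is related by \<open>tau S\<close> to
  \<open>b\<degree>\<close>, hence idempotent.\<close>

lemma beta_Int_tau_subset_rel_F: "beta S \<inter> tau S \<subseteq> rel_F S"
proof -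
  note \<tau> = tau_congruence
  have "a \<cdot> b\<^sup>- \<in> idempotents S"
    if ab: "(a, b) \<in> tau S" and C: "a \<in> carrier S" "b \<in> carrier S" for a b
  proof -
    have "(a \<cdot> b\<^sup>-, b \<cdot> b\<^sup>-) \<in> tau S"
      using congruence_mult[OF \<tau> ab congruence_refl[OF \<tau> inv_closed]] C by blast
    then have "(a \<cdot> b\<^sup>-, b\<degree>) \<in> tau S" using C by (simp add: mult_inv)
    then show ?thesis
      using tau_idempotent_pure zero_idempotent[OF C(2)] closed[OF C(1) inv_closed[OF C(2)]]
      unfolding idempotent_pure_def by blast
  qed
  then show ?thesis using congruence_subset[OF \<tau>] by (auto simp: rel_F_def)
qed

lemma beta_Int_eqs:
  assumes "idempotent_pure S (kappa S)"
  shows "beta S \<inter> rel_F S = beta S \<inter> rel_Theta S" "beta S \<inter> rel_Theta S = beta S \<inter> tau S"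
    and "beta S \<inter> rel_Theta S = kappa S"
  using beta_Int_rel_F_subset[OF assms] beta_Int_rel_Theta_subset[OF assms] kappa_subset_beta
    assms idempotent_pure_kappa_iff_subset_tau beta_Int_tau_subset_rel_F by blast+

section \<open>From the other conditions back to purity\<close>

text \<open>Any two idempotents are \<open>\<Theta>\<close>-related, so \<open>\<beta> \<inter> \<Theta>\<close> has the trace of \<open>\<beta>\<close>, while
  \<open>a \<Theta> a\<degree>\<close> forces \<open>a = a\<degree>\<close>.\<close>

lemma idempotent_pure_if_congruence_Theta:
  assumes c: "congruence S (beta S \<inter> rel_Theta S)"
  shows "idempotent_pure S (kappa S)"
proof -
  have "((a \<cdot> b)\<degree>, (a\<degree> \<cdot> b\<degree>)\<degree>) \<in> beta S \<inter> rel_Theta S"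
    if "a \<in> carrier S" "b \<in> carrier S" for a b
    using that band_congruence_cryptogroup[OF beta_band_congruence]
    by (auto simp: cryptogroup_congruence_iff rel_Theta_def zero_closed closed zero_zero)
  then have "cryptogroup_congruence S (beta S \<inter> rel_Theta S)"
    using c by (auto simp: cryptogroup_congruence_iff)
  then have sub: "kappa S \<subseteq> rel_Theta S" using kappa_least by blast
  show ?thesis
  proof (rule idempotent_pure_if_zero_eq)
    fix a assume "a \<in> carrier S" "(a, a\<degree>) \<in> kappa S"
    then show "a = a\<degree>"
      using sub by (auto simp: rel_Theta_def zero_zero zero_idem mult_zero)
  qed
qed

text \<open>The pairs that generate \<open>kappa S\<close> consist of idempotents and lie in
  \<open>beta S\<close>, so they belong to its trace; the assumption then makes \<open>tau S\<close>
  a cryptogroup congruence.\<close>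

lemma idempotent_pure_if_trace:
  assumes "trace S (beta S) \<subseteq> trace S (tau S)"
  shows "idempotent_pure S (kappa S)"
proof -
  have "((a \<cdot> b)\<degree>, (a\<degree> \<cdot> b\<degree>)\<degree>) \<in> tau S" if C: "a \<in> carrier S" "b \<in> carrier S" for a b
  proof -
    have "((a \<cdot> b)\<degree>, (a\<degree> \<cdot> b\<degree>)\<degree>) \<in> trace S (beta S)"
      using C band_congruence_cryptogroup[OF beta_band_congruence]
      by (auto simp: cryptogroup_congruence_iff trace_def zero_idempotent closed zero_closed)
    then show ?thesis using assms by (auto simp: trace_def)
  qed
  then have "cryptogroup_congruence S (tau S)"
    using tau_congruence by (auto simp: cryptogroup_congruence_iff)
  then show ?thesis using kappa_least idempotent_pure_kappa_iff_subset_tau by blast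
qed

text \<open>The class of \<open>a\<degree>\<close> contains \<open>a\<close>, and its rectangular
  law reads \<open>a\<degree> = a\<degree> \<cdot> a \<cdot> a\<degree> = a\<close>.\<close>

lemma idempotent_pure_if_over_rectangular_bands:
  assumes "over_rectangular_bands S (kappa S)"
  shows "idempotent_pure S (kappa S)"
proof (rule idempotent_pure_if_zero_eq)
  fix a assume a: "a \<in> carrier S" "(a, a\<degree>) \<in> kappa S"
  let ?K = "kappa S `` {a\<degree>}"
  have "rectangular_band (subsemigrp S ?K)"
    using assms a zero_idempotent by (simp add: over_rectangular_bands_def)
  moreover have "a \<in> ?K" "a\<degree> \<in> ?K"
    using a congruence_sym[OF kappa_congruence] congruence_refl[OF kappa_congruence] zero_closed
    by simp_all
  ultimately have "a\<degree> = a\<degree> \<cdot> a \<cdot> a\<degree>" by (simp add: rectangular_band_def subsemigrp_def)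
  then show "a = a\<degree>" using a by (simp add: zero_mult mult_zero)
qed

lemma idempotent_pure_if_Int_green_H:
  assumes "kappa S \<inter> green_H S = Id_on (carrier S)"
  shows "idempotent_pure S (kappa S)"
proof (rule idempotent_pure_if_zero_eq)
  fix a assume "a \<in> carrier S" "(a, a\<degree>) \<in> kappa S"
  then have "(a, a\<degree>) \<in> kappa S \<inter> green_H S" by (simp add: green_H_eq zero_closed zero_zero)
  then show "a = a\<degree>" unfolding assms by (simp add: Id_on_iff)
qed

text \<open>Here \<open>a \<cdot> (a\<degree>)\<^sup>-\<close> is just \<open>a\<close>.\<close>

lemma idempotent_pure_if_rel_F:
  assumes "kappa S \<subseteq> rel_F S"
  shows "idempotent_pure S (kappa S)"
proof (rule idempotent_pure_if_zero_eq)
  fix a assume a: "a \<in> carrier S" "(a, a\<degree>) \<in> kappa S"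
  then have "a \<cdot> (a\<degree>)\<^sup>- \<in> idempotents S" using assms by (auto simp: rel_F_def)
  then show "a = a\<degree>"
    using a by (simp add: inv_idempotent zero_idempotent mult_zero zero_of_idempotent)
qed

text \<open>\<open>a\<degree>\<close> is an inverse of itself, hence of \<open>a\<close>, so
  \<open>a\<degree> = a\<degree> \<cdot> a \<cdot> a\<degree> = a\<close>.\<close>

lemma idempotent_pure_if_rel_Y:
  assumes "kappa S \<subseteq> rel_Y S"
  shows "idempotent_pure S (kappa S)"
proof (rule idempotent_pure_if_zero_eq)
  fix a assume a: "a \<in> carrier S" "(a, a\<degree>) \<in> kappa S"
  then have "a\<degree> \<in> inverses S a \<longleftrightarrow> a\<degree> \<in> inverses S a\<degree>" using assms by (auto simp: rel_Y_def)
  then have "a\<degree> \<in> inverses S a" using a by (simp add: inverses_def zero_closed zero_idem)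
  then show "a = a\<degree>" using a by (simp add: inverses_def zero_mult mult_zero)
qed

lemma over_rectangular_bands_iff:
  "over_rectangular_bands S (kappa S) \<longleftrightarrow> idempotent_pure S (kappa S)"
  using over_rectangular_bands_kappa idempotent_pure_if_over_rectangular_bands by blast

lemma trace_kappa_subset_tau:
  assumes "idempotent_pure S (kappa S)"
  shows "trace S (beta S) \<subseteq> trace S (tau S)"
  using assms idempotent_pure_kappa_iff_subset_tau unfolding trace_beta by (auto simp: trace_def)

end

theorem theorem3p4:
  fixes S :: "'a semigrp"
  assumes "completely_regular S"
  shows
    "(over_rectangular_bands S (kappa S) \<longleftrightarrow>
        beta S \<inter> rel_F S = beta S \<inter> rel_Theta S \<and>
        beta S \<inter> rel_Theta S = beta S \<inter> tau S) \<and>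
     (over_rectangular_bands S (kappa S) \<longleftrightarrow>
        congruence S (beta S \<inter> rel_Theta S)) \<and>
     (over_rectangular_bands S (kappa S) \<longleftrightarrow>
        kappa S \<inter> green_H S = Id_on (carrier S)) \<and>
     (over_rectangular_bands S (kappa S) \<longleftrightarrow>
        kappa S \<subseteq> tau S) \<and>
     (over_rectangular_bands S (kappa S) \<longleftrightarrow>
        lower_k S (kappa S) = Id_on (carrier S)) \<and>
     (over_rectangular_bands S (kappa S) \<longleftrightarrow>
        (\<exists>\<rho>. cryptogroup_congruence S \<rho> \<and> idempotent_pure S \<rho>)) \<and>
     (over_rectangular_bands S (kappa S) \<longleftrightarrow>
        kappa S \<subseteq> rel_F S) \<and>
     (over_rectangular_bands S (kappa S) \<longleftrightarrow>
        band_of_rectangular_groups S \<and> trace S (beta S) \<subseteq> trace S (tau S)) \<and>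
     (over_rectangular_bands S (kappa S) \<longleftrightarrow>
        kappa S \<subseteq> rel_Y S)"
proof -
  interpret cr_semigrp S
    using assms by (simp add: cr_semigrp_def cr_semigrp_axioms_def completely_regular_def)
  note \<kappa> = kappa_congruence
  show ?thesis
    unfolding over_rectangular_bands_iff
  proof (intro conjI)
    show "idempotent_pure S (kappa S) \<longleftrightarrow>
        beta S \<inter> rel_F S = beta S \<inter> rel_Theta S \<and> beta S \<inter> rel_Theta S = beta S \<inter> tau S"
      \<comment> \<open>For the converse, equality with \<open>beta S \<inter> tau S\<close>
        exhibits \<open>beta S \<inter> rel_Theta S\<close> as a congruence.\<close>
      using beta_Int_eqs(1,2) idempotent_pure_if_congruence_Theta
        congruence_Int[OF beta_congruence tau_congruence] by metis
    show "idempotent_pure S (kappa S) \<longleftrightarrow> congruence S (beta S \<inter> rel_Theta S)"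
      \<comment> \<open>Under purity the intersection is \<open>kappa S\<close> itself.\<close>
      using beta_Int_eqs(3) idempotent_pure_if_congruence_Theta \<kappa> by metis
    show "idempotent_pure S (kappa S) \<longleftrightarrow> kappa S \<inter> green_H S = Id_on (carrier S)"
      using kappa_Int_green_H idempotent_pure_if_Int_green_H by blast
    show "idempotent_pure S (kappa S) \<longleftrightarrow> kappa S \<subseteq> tau S"
      by (rule idempotent_pure_kappa_iff_subset_tau)
    show "idempotent_pure S (kappa S) \<longleftrightarrow> lower_k S (kappa S) = Id_on (carrier S)"
      by (rule idempotent_pure_iff_lower_k[OF \<kappa>])
    show "idempotent_pure S (kappa S) \<longleftrightarrow>
        (\<exists>\<rho>. cryptogroup_congruence S \<rho> \<and> idempotent_pure S \<rho>)"
      by (rule idempotent_pure_kappa_iff_cryptogroup_congruence)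
    show "idempotent_pure S (kappa S) \<longleftrightarrow> kappa S \<subseteq> rel_F S"
      using kappa_subset_rel_F idempotent_pure_if_rel_F by blast
    show "idempotent_pure S (kappa S) \<longleftrightarrow>
        band_of_rectangular_groups S \<and> trace S (beta S) \<subseteq> trace S (tau S)"
      \<comment> \<open>The band congruence whose classes are rectangular groups is
        \<open>beta S\<close>.\<close>
      unfolding band_of_rectangular_groups_def
      using beta_band_congruence beta_class_rectangular_group trace_kappa_subset_tau
        idempotent_pure_if_trace by blast
    show "idempotent_pure S (kappa S) \<longleftrightarrow> kappa S \<subseteq> rel_Y S"
      using kappa_subset_rel_Y idempotent_pure_if_rel_Y by blast
  qed
qed

end
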